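(* (1) Let $p$ be a prime and let $(B,+,\circ)$ be a finite two-sided skew brace. Then the Sylow $p$-sub-skew braces of $B$ coincide with the Sylow $p$-subgroups of $(B,\circ)$; that is, a subset of $B$ is a Sylow $p$-sub-skew brace of $B$ if and only if it is a Sylow $p$-subgroup of $(B,\circ)$. (2) Let $\pi$ be a set of primes and let $(B,+,\circ)$ be a finite soluble two-sided skew brace. Then the Hall $\pi$-sub-skew braces of $B$ coincide with the Hall $\pi$-subgroups of $(B,\circ)$; that is, a subset of $B$ is a Hall $\pi$-sub-skew brace of $B$ if and only if it is a Hall $\pi$-subgroup of $(B,\circ)$.
   Context: A skew (left) brace is a triple $(B,+,\circ)$ where $(B,+)$ and $(B,\circ)$ are (not necessarily abelian) groups with $a\circ(b+c)=a\circ b-a+a\circ c$ for all $a,b,c\in B$. It is two-sided if in addition $(b+c)\circ a=b\circ a-a+c\circ a$ for all $a,b,c\in B$. Put $\lambda_a(b)=-a+a\circ b$. A sub-skew brace of $B$ is a subset that is a subgroup of both $(B,+)$ and $(B,\circ)$. An ideal of $B$ is a subset $I$ that is a normal subgroup of $(B,+)$, a normal subgroup of $(B,\circ)$, and satisfies $\lambda_a(I)\subseteq I$ for all $a\in B$; then $B/I$ is a skew brace with the induced operations. A skew brace is trivial of abelian type if its two operations coincide and its additive group is abelian. $B$ is soluble if there is a finite chain $\{0\}=I_0\leq I_1\leq\ldots\leq I_n=B$ of ideals of $B$ such that each $I_{j+1}/I_j$ is a trivial skew brace of abelian type. A $\pi$-number is a positive integer all of whose prime divisors lie in $\pi$. For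 a finite skew brace $B$, a Sylow $p$-sub-skew brace (resp. Hall $\pi$-sub-skew brace) is a sub-skew brace whose order is the largest power of $p$ (resp. the largest $\pi$-number) dividing $|B|$. *)

theory Defs
  imports "HOL-Algebra.QuotRing" "HOL-Algebra.Sylow"
begin

text \<open>
  A skew brace \<open>(B, +, \<circ>)\<close> is carried by the record type of rings: \<open>\<oplus>\<close> is the additive operation
  \<open>+\<close> and \<open>\<otimes>\<close> is the operation \<open>\<circ>\<close>. Hence \<open>add_monoid B\<close> is the group \<open>(B, +)\<close>, while \<open>B\<close> itself,
  read as a monoid record, is the group \<open>(B, \<circ>)\<close>; for instance \<open>subgroup H B\<close> says that \<open>H\<close> is a
  subgroup of \<open>(B, \<circ>)\<close>. The two neutral elements are not assumed equal, since this follows.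
\<close>

locale skew_brace =
  fixes B :: "('a, 'b) ring_scheme" (structure)
  assumes add_group: "group (add_monoid B)"
    and circ_group: "group B"
    and brace: "\<lbrakk>a \<in> carrier B; b \<in> carrier B; c \<in> carrier B\<rbrakk>
      \<Longrightarrow> a \<otimes> (b \<oplus> c) = (a \<otimes> b \<ominus> a) \<oplus> a \<otimes> c"

locale two_sided_skew_brace = skew_brace +
  assumes right_brace: "\<lbrakk>a \<in> carrier B; b \<in> carrier B; c \<in> carrier B\<rbrakk>
      \<Longrightarrow> (b \<oplus> c) \<otimes> a = (b \<otimes> a \<ominus> a) \<oplus> c \<otimes> a"

locale trivial_abelian_skew_brace = skew_brace +
  assumes trivial: "\<lbrakk>a \<in> carrier B; b \<in> carrier B\<rbrakk> \<Longrightarrow> a \<otimes> b = a \<oplus> b"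
    and add_comm_group: "comm_group (add_monoid B)"

definition brace_lambda :: "('a, 'b) ring_scheme \<Rightarrow> 'a \<Rightarrow> 'a \<Rightarrow> 'a" where
  "brace_lambda B a b = (\<ominus>\<^bsub>B\<^esub> a) \<oplus>\<^bsub>B\<^esub> (a \<otimes>\<^bsub>B\<^esub> b)"

definition sub_skew_brace :: "'a set \<Rightarrow> ('a, 'b) ring_scheme \<Rightarrow> bool" where
  "sub_skew_brace H B \<longleftrightarrow> subgroup H (add_monoid B) \<and> subgroup H B"

definition skew_brace_ideal :: "'a set \<Rightarrow> ('a, 'b) ring_scheme \<Rightarrow> bool" where
  "skew_brace_ideal I B \<longleftrightarrow>
     I \<lhd> add_monoid B \<and> I \<lhd> B \<and> (\<forall>a\<in>carrier B. brace_lambda B a ` I \<subseteq> I)"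

text \<open>
  The quotient of skew braces is the library's \<open>B Quot I\<close>. Its carrier consists of the additive cosets
  of \<open>I\<close>, and its operations are the induced ones; the lemmas \<open>quot_add\<close>, \<open>quot_mult\<close> and
  \<open>skew_brace_quot\<close> below confirm this without any ring axiom.
\<close>

definition soluble_skew_brace :: "('a, 'b) ring_scheme \<Rightarrow> bool" where
  "soluble_skew_brace B \<longleftrightarrow>
     (\<exists>(n::nat) I. I 0 = {\<zero>\<^bsub>B\<^esub>} \<and> I n = carrier B
        \<and> (\<forall>j\<le>n. skew_brace_ideal (I j) B)
        \<and> (\<forall>j<n. I j \<subseteq> I (Suc j)
              \<and> trivial_abelian_skew_brace ((B\<lparr>carrier := I (Suc j)\<rparr>) Quot (I j))))"

definition pi_number :: "nat set \<Rightarrow> nat \<Rightarrow> bool" where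
  "pi_number \<pi> n \<longleftrightarrow> 0 < n \<and> (\<forall>q. Factorial_Ring.prime q \<and> q dvd n \<longrightarrow> q \<in> \<pi>)"

text \<open>The following four notions are meant for finite groups and finite skew braces only.\<close>

definition sylow_subgroup :: "nat \<Rightarrow> 'a set \<Rightarrow> ('a, 'b) monoid_scheme \<Rightarrow> bool" where
  "sylow_subgroup p H G \<longleftrightarrow> subgroup H G \<and> card H = p ^ multiplicity p (order G)"

definition sylow_sub_skew_brace :: "nat \<Rightarrow> 'a set \<Rightarrow> ('a, 'b) ring_scheme \<Rightarrow> bool" where
  "sylow_sub_skew_brace p H B \<longleftrightarrow> sub_skew_brace H B \<and> card H = p ^ multiplicity p (order B)"

definition hall_subgroup :: "nat set \<Rightarrow> 'a set \<Rightarrow> ('a, 'b) monoid_scheme \<Rightarrow> bool" where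
  "hall_subgroup \<pi> H G \<longleftrightarrow> subgroup H G \<and> card H = Max {d. pi_number \<pi> d \<and> d dvd order G}"

definition hall_sub_skew_brace :: "nat set \<Rightarrow> 'a set \<Rightarrow> ('a, 'b) ring_scheme \<Rightarrow> bool" where
  "hall_sub_skew_brace \<pi> H B \<longleftrightarrow>
     sub_skew_brace H B \<and> card H = Max {d. pi_number \<pi> d \<and> d dvd order B}"


lemma quot_carrier: "carrier (B Quot I) = carrier (add_monoid B Mod I)"
  by (simp add: FactRing_def FactGroup_def A_RCOSETS_def)

lemma add_monoid_quot: "add_monoid (B Quot I) = add_monoid B Mod I"
  by (simp add: FactRing_def FactGroup_def A_RCOSETS_def set_add_def)

context skew_brace
begin

sublocale A: group "add_monoid B"
  rewrites "carrier (add_monoid B) = carrier B"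
    and "monoid.mult (add_monoid B) = ring.add B"
    and "monoid.one (add_monoid B) = ring.zero B"
    and "m_inv (add_monoid B) = a_inv B"
  using add_group by (simp_all add: a_inv_def)

sublocale C: group B
  by (rule circ_group)

lemma zero_eq_one: "\<zero> = \<one>"
proof -
  have "\<one> \<otimes> (\<zero> \<oplus> \<zero>) = (\<one> \<otimes> \<zero> \<ominus> \<one>) \<oplus> \<one> \<otimes> \<zero>"
    by (rule brace) simp_all
  then have "\<zero> = \<ominus> \<one>"
    by (simp add: a_minus_def)
  then show ?thesis
    by (metis A.inv_equality A.inv_inv A.inv_one C.one_closed)
qed

lemma circ_eq: "\<lbrakk>a \<in> carrier B; b \<in> carrier B\<rbrakk> \<Longrightarrow> a \<otimes> b = a \<oplus> brace_lambda B a b"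
  by (simp add: brace_lambda_def A.m_assoc[symmetric])

lemma cosets_eq:
  assumes I: "skew_brace_ideal I B" and x: "x \<in> carrier B"
  shows "I +> x = I #> x"
proof -
  interpret NA: normal I "add_monoid B" using I by (simp add: skew_brace_ideal_def)
  interpret NC: normal I B using I by (simp add: skew_brace_ideal_def)
  have sub: "I \<subseteq> carrier B" using NC.subset .
  have lam: "brace_lambda B a i \<in> I" if "a \<in> carrier B" "i \<in> I" for a i
    using I that by (auto simp: skew_brace_ideal_def)
  have "I +> x = x <+ I"
    using NA.coset_eq x by (simp add: a_r_coset_def a_l_coset_def)
  moreover have "x <+ I = x <# I"
  proof
    show "x <# I \<subseteq> x <+ I"
    proof
      fix y assume "y \<in> x <# I"
      then obtain i where i: "i \<in> I" "y = x \<otimes> i" by (auto simp: l_coset_def)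
      then have "y = x \<oplus> brace_lambda B x i" using circ_eq x sub by auto
      then show "y \<in> x <+ I" using lam[OF x i(1)] by (auto simp: a_l_coset_def l_coset_def)
    qed
  next
    show "x <+ I \<subseteq> x <# I"
    proof
      fix y assume "y \<in> x <+ I"
      then obtain i where i: "i \<in> I" "y = x \<oplus> i" by (auto simp: a_l_coset_def l_coset_def)
      have iB: "i \<in> carrier B" using i sub by auto
      let ?x = "inv\<^bsub>B\<^esub> x"
      have "?x \<otimes> y = (?x \<otimes> x \<ominus> ?x) \<oplus> ?x \<otimes> i"
        unfolding i(2) by (rule brace) (use x iB in auto)
      also have "\<dots> = brace_lambda B ?x i"
        using x iB by (simp add: brace_lambda_def a_minus_def zero_eq_one[symmetric])
      finally have "?x \<otimes> y \<in> I" using lam[of ?x i] x i by auto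
      moreover have "y = x \<otimes> (?x \<otimes> y)"
        using x i iB by (simp add: C.m_assoc[symmetric])
      ultimately show "y \<in> x <# I" by (auto simp: l_coset_def)
    qed
  qed
  ultimately show ?thesis using NC.coset_eq x by simp
qed

lemma quot_add:
  assumes I: "skew_brace_ideal I B" and "x \<in> carrier B" "y \<in> carrier B"
  shows "(I +> x) \<oplus>\<^bsub>B Quot I\<^esub> (I +> y) = I +> (x \<oplus> y)"
proof -
  interpret NA: normal I "add_monoid B" using I by (simp add: skew_brace_ideal_def)
  show ?thesis using NA.rcos_sum[of x y] assms
    by (simp add: FactRing_def a_r_coset_def set_add_def)
qed

lemma quot_mult:
  assumes I: "skew_brace_ideal I B" and x: "x \<in> carrier B" and y: "y \<in> carrier B"
  shows "(I +> x) \<otimes>\<^bsub>B Quot I\<^esub> (I +> y) = I +> (x \<otimes> y)"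
proof -
  interpret NC: normal I B using I by (simp add: skew_brace_ideal_def)
  have eq: "I #> (a \<otimes> b) = I #> (x \<otimes> y)" if "a \<in> I #> x" "b \<in> I #> y" for a b
  proof -
    have ab: "a \<in> carrier B" "b \<in> carrier B"
      using that x y NC.subset C.r_coset_subset_G by blast+
    have "I #> a = I #> x" "I #> b = I #> y"
      using that x y NC.subgroup_axioms C.repr_independence by blast+
    then show ?thesis using NC.rcos_sum[of a b] NC.rcos_sum[of x y] ab x y by simp
  qed
  have sub: "I #> x \<subseteq> carrier B" "I #> y \<subseteq> carrier B"
    using x y NC.subset C.r_coset_subset_G by blast+
  have mem: "x \<in> I #> x" "y \<in> I #> y"
    using x y NC.subgroup_axioms C.rcos_self by blast+
  have "(I +> x) \<otimes>\<^bsub>B Quot I\<^esub> (I +> y) = (\<Union>a\<in>I #> x. \<Union>b\<in>I #> y. I +> (a \<otimes> b))"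
    by (simp add: FactRing_def rcoset_mult_def cosets_eq[OF I] x y)
  also have "\<dots> = (\<Union>a\<in>I #> x. \<Union>b\<in>I #> y. I #> (a \<otimes> b))"
    using sub by (intro SUP_cong refl cosets_eq[OF I] C.m_closed) auto
  also have "\<dots> = I #> (x \<otimes> y)"
    using eq mem by blast
  finally show ?thesis using cosets_eq[OF I] x y by simp
qed

lemma skew_brace_quot:
  assumes I: "skew_brace_ideal I B"
  shows "skew_brace (B Quot I)"
proof -
  interpret NA: normal I "add_monoid B" using I by (simp add: skew_brace_ideal_def)
  interpret NC: normal I B using I by (simp add: skew_brace_ideal_def)
  let ?Q = "B Quot I"
  note add = quot_add[OF I] and mult = quot_mult[OF I]
  have carr: "X \<in> carrier ?Q \<longleftrightarrow> (\<exists>x\<in>carrier B. X = I +> x)" for X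
    by (auto simp: FactRing_def A_RCOSETS_def RCOSETS_def a_r_coset_def)
  have AG: "group (add_monoid ?Q)"
    unfolding add_monoid_quot by (rule NA.factorgroup_is_group)
  have one: "\<one>\<^bsub>?Q\<^esub> = I +> \<one>" by (simp add: FactRing_def)
  have CG: "group ?Q"
  proof (rule groupI)
    fix X assume "X \<in> carrier ?Q"
    then obtain x where x: "x \<in> carrier B" "X = I +> x" by (auto simp: carr)
    then have "I +> (inv\<^bsub>B\<^esub> x) \<in> carrier ?Q" "(I +> (inv\<^bsub>B\<^esub> x)) \<otimes>\<^bsub>?Q\<^esub> X = \<one>\<^bsub>?Q\<^esub>"
      by (auto simp: carr mult one)
    then show "\<exists>Y\<in>carrier ?Q. Y \<otimes>\<^bsub>?Q\<^esub> X = \<one>\<^bsub>?Q\<^esub>" by blast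
  next
    show "\<one>\<^bsub>?Q\<^esub> \<in> carrier ?Q" by (auto simp: carr one)
  qed (auto simp: carr mult one C.m_assoc intro: C.m_closed)
  interpret QA: group "add_monoid ?Q" by (rule AG)
  have minus: "\<ominus>\<^bsub>?Q\<^esub> (I +> x) = I +> (\<ominus> x)" if "x \<in> carrier B" for x
  proof -
    have "(I +> (\<ominus> x)) \<oplus>\<^bsub>?Q\<^esub> (I +> x) = I +> \<zero>"
      using that by (simp add: add)
    also have "\<dots> = \<zero>\<^bsub>?Q\<^esub>"
      using A.coset_mult_one[of I] NA.subset by (simp add: FactRing_def a_r_coset_def)
    moreover have "I +> x \<in> carrier ?Q" "I +> (\<ominus> x) \<in> carrier ?Q"
      using that by (auto simp: carr)
    ultimately show ?thesis
      using QA.inv_equality by (simp add: a_inv_def)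
  qed
  show ?thesis
  proof (rule skew_brace.intro)
    show "group (add_monoid ?Q)" by (rule AG)
    show "group ?Q" by (rule CG)
  next
    fix X Y Z assume "X \<in> carrier ?Q" "Y \<in> carrier ?Q" "Z \<in> carrier ?Q"
    then obtain x y z where "x \<in> carrier B" "X = I +> x" "y \<in> carrier B" "Y = I +> y"
        "z \<in> carrier B" "Z = I +> z"
      by (auto simp: carr)
    then show "X \<otimes>\<^bsub>?Q\<^esub> (Y \<oplus>\<^bsub>?Q\<^esub> Z) = (X \<otimes>\<^bsub>?Q\<^esub> Y \<ominus>\<^bsub>?Q\<^esub> X) \<oplus>\<^bsub>?Q\<^esub> X \<otimes>\<^bsub>?Q\<^esub> Z"
      by (simp add: add mult minus a_minus_def brace)
  qed
qed

text \<open>By the next two lemmas, the quotients occurring in \<open>soluble_skew_brace\<close> are automatically skew braces.\<close>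

lemma skew_brace_restrict:
  assumes J: "sub_skew_brace J B"
  shows "skew_brace (B\<lparr>carrier := J\<rparr>)"
    and "\<And>a. a \<in> J \<Longrightarrow> \<ominus>\<^bsub>B\<lparr>carrier := J\<rparr>\<^esub> a = \<ominus> a"
proof -
  have sA: "subgroup J (add_monoid B)" and sC: "subgroup J B"
    using J by (auto simp: sub_skew_brace_def)
  have sub: "J \<subseteq> carrier B" using sC subgroup.subset by blast
  show minus: "\<ominus>\<^bsub>B\<lparr>carrier := J\<rparr>\<^esub> a = \<ominus> a" if "a \<in> J" for a
    using group.m_inv_consistent[OF add_group sA that] by (simp add: a_inv_def)
  show "skew_brace (B\<lparr>carrier := J\<rparr>)"
  proof (rule skew_brace.intro)
    show "group (add_monoid (B\<lparr>carrier := J\<rparr>))"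
      using subgroup.subgroup_is_group[OF sA add_group] by simp
    show "group (B\<lparr>carrier := J\<rparr>)"
      using subgroup.subgroup_is_group[OF sC circ_group] by simp
  qed (use sub minus brace in \<open>auto simp: a_minus_def subset_iff\<close>)
qed

lemma skew_brace_ideal_restrict:
  assumes I: "skew_brace_ideal I B" and J: "sub_skew_brace J B" and IJ: "I \<subseteq> J"
  shows "skew_brace_ideal I (B\<lparr>carrier := J\<rparr>)"
proof -
  have sA: "subgroup J (add_monoid B)" and sC: "subgroup J B"
    using J by (auto simp: sub_skew_brace_def)
  have sub: "J \<subseteq> carrier B" using sC subgroup.subset by blast
  have "I \<lhd> add_monoid (B\<lparr>carrier := J\<rparr>)"
    using group.normal_restrict_supergroup[OF add_group sA _ IJ] I by (simp add: skew_brace_ideal_def)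
  moreover have "I \<lhd> B\<lparr>carrier := J\<rparr>"
    using group.normal_restrict_supergroup[OF circ_group sC _ IJ] I by (simp add: skew_brace_ideal_def)
  moreover have "brace_lambda (B\<lparr>carrier := J\<rparr>) a = brace_lambda B a" if "a \<in> J" for a
    using skew_brace_restrict(2)[OF J that] by (simp add: brace_lambda_def fun_eq_iff)
  moreover have "brace_lambda B a ` I \<subseteq> I" if "a \<in> J" for a
    using I sub that unfolding skew_brace_ideal_def by blast
  ultimately show ?thesis
    unfolding skew_brace_ideal_def by simp
qed

end

end

theory Submission
  imports Defs "HOL-Algebra.Multiplicative_Group" "HOL-Algebra.Zassenhaus" "HOL-Number_Theory.Cong"
begin

text \<open>
  A sub-skew brace is a subgroup of \<open>(B, \<circ>)\<close> by definition, so what matters is that a Sylow or Hall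
  subgroup \<open>P\<close> of \<open>(B, \<circ>)\<close> is closed under \<open>+\<close>. The case of a Sylow
  \<open>p\<close>-subgroup is the case \<open>\<pi> = {p}\<close> of a single statement (\<open>maximal_pi_subgroup_add_subgroup\<close>): a
  subgroup of \<open>(B, \<circ>)\<close> whose order is the largest \<open>\<pi>\<close>-number dividing \<open>|B|\<close> is an additive subgroup.

  The first step reduces everything to an abelian ideal. In a two-sided skew brace conjugation in
  \<open>(B, \<circ>)\<close> is an automorphism of \<open>(B, +)\<close> (\<open>conj_add\<close>), and expanding \<open>(a + b) \<circ> (c + d)\<close> in two ways
  shows that every \<open>-a + a \<circ> d - d\<close> commutes additively with every \<open>-c + b \<circ> c - b\<close>
  (\<open>star_commute\<close>). Let \<open>Y\<close> be the additive centralizer of all the elements \<open>-a + a \<circ> d - d\<close> and \<open>X\<close>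
  the additive centralizer of \<open>Y\<close>. Both are ideals; modulo \<open>X\<close> the operations \<open>\<circ>\<close> and \<open>+\<close>
  agree, and modulo \<open>Y\<close> the operation \<open>\<circ>\<close> is the opposite of \<open>+\<close>. Hence \<open>X \<circ> P\<close> and \<open>Y \<circ> P\<close> are additive
  subgroups, and so is their intersection \<open>K\<close>. The ideal \<open>Z = X \<inter> Y\<close> is additively abelian and
  \<open>K/Z\<close> is a \<open>\<pi>\<close>-group. If \<open>M\<close> is the \<open>\<pi>'\<close>-part of \<open>(Z, +)\<close>, then \<open>M\<close> is an ideal of
  \<open>B\<close>, and comparing orders gives \<open>K = M \<circ> P\<close>.

  The second step is a coprime averaging argument (\<open>P_add_closed\<close>). For \<open>x\<close> in \<open>K\<close> let \<open>rep x\<close> be the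
  element of \<open>P\<close> in the coset \<open>M + x\<close>. The elements \<open>g(y, b) = b - rep (y + b) + y\<close> of \<open>M\<close> measure
  how far \<open>P\<close> is from being additively closed. Since \<open>|P|\<close> is invertible on the abelian group \<open>M\<close>, one
  may form the mean \<open>G(y)\<close> of \<open>g(y, b)\<close> over \<open>b\<close> in \<open>P\<close> and the mean \<open>s\<close> of \<open>G(y)\<close> over \<open>y\<close> in \<open>P\<close>. Three
  facts follow. Associativity of \<open>+\<close> makes \<open>g\<close> a 2-cocycle, which is therefore expressed through \<open>G\<close>.
  The left brace law makes \<open>G\<close> a 1-cocycle of \<open>P\<close> acting by \<open>\<lambda>\<close>, so \<open>G(c) = s - \<lambda>\<^sub>c(s)\<close>. Finally,
  conjugation by \<open>P\<close> permutes all the data, so \<open>s\<close> commutes with \<open>P\<close> in \<open>(B, \<circ>)\<close>, which turns the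
  previous formula into \<open>G(c) = -\<theta>(c) + c\<close> for the additive automorphism
  \<open>\<theta>(x) = s + \<lambda>\<^sub>s(x) - s\<close>. Substituting this in the cocycle relation gives
  \<open>\<theta>(rep (a + b)) = \<theta>(a + b)\<close>, so \<open>a + b = rep (a + b)\<close> lies in \<open>P\<close>.
\<close>

section \<open>Finite groups\<close>

lemma (in group) pow_card_subgroup:
  assumes H: "subgroup H G" and x: "x \<in> H"
  shows "x [^] card H = \<one>"
proof -
  have "x [^]\<^bsub>G\<lparr>carrier := H\<rparr>\<^esub> card H = \<one>"
    using group.pow_order_eq_1[OF subgroup.subgroup_is_group[OF H group_axioms], of x] x
    by (simp add: order_def)
  then show ?thesis by (simp add: nat_pow_consistent[symmetric])
qed

lemma (in group) finite_closed_imp_subgroup: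
  assumes fin: "finite H" and H: "H \<subseteq> carrier G" "H \<noteq> {}"
    and closed: "\<And>x y. \<lbrakk>x \<in> H; y \<in> H\<rbrakk> \<Longrightarrow> x \<otimes> y \<in> H"
  shows "subgroup H G"
proof (rule subgroupI)
  fix a assume a: "a \<in> H"
  have aG: "a \<in> carrier G" using a H by auto
  have surj: "(\<lambda>x. a \<otimes> x) ` H = H"
    using fin H a closed by (intro endo_inj_surj inj_onI) (auto simp: subset_iff)
  have "a \<in> (\<lambda>x. a \<otimes> x) ` H" using surj a by simp
  then obtain e where e: "e \<in> H" "a = a \<otimes> e" by (elim imageE)
  have "e = \<one>" using e aG H(1) l_cancel_one'[of a e] by auto
  then have "\<one> \<in> (\<lambda>x. a \<otimes> x) ` H" using surj e(1) by simp
  then obtain b where b: "b \<in> H" "\<one> = a \<otimes> b" by (elim imageE)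
  have bG: "b \<in> carrier G" using b H by auto
  have "inv a = b" using inv_equality[OF inv_comm[OF b(2)[symmetric] aG bG] aG bG] .
  then show "inv a \<in> H" using b by simp
qed (use H closed in auto)

lemma (in group) coprime_subgroups_Int:
  assumes H: "subgroup H G" and K: "subgroup K G" and cop: "coprime (card H) (card K)"
    and x: "x \<in> H" "x \<in> K"
  shows "x = \<one>"
proof -
  have xG: "x \<in> carrier G" using subgroup.mem_carrier[OF H x(1)] .
  have dvd: "ord x dvd card L" if "subgroup L G" "x \<in> L" for L
    using pow_card_subgroup[OF that] pow_eq_id[OF xG] by simp
  have "ord x = 1"
    using dvd[OF H x(1)] dvd[OF K x(2)] cop coprime_common_divisor_nat by blast
  then show ?thesis using ord_eq_1 xG by simp
qed

lemma (in group) card_set_mult_coprime: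
  assumes H: "subgroup H G" and K: "subgroup K G" and cop: "coprime (card H) (card K)"
  shows "card (H <#> K) = card H * card K"
proof -
  have cancel: "h = h' \<and> k = k'"
    if hk: "h \<in> H" "k \<in> K" "h' \<in> H" "k' \<in> K" and eq: "h \<otimes> k = h' \<otimes> k'" for h k h' k'
  proof -
    note [simp] = subgroup.mem_carrier[OF H] subgroup.mem_carrier[OF K]
    have "inv h' \<otimes> h = inv h' \<otimes> (h \<otimes> k) \<otimes> inv k" using hk by (simp add: m_assoc)
    also have "\<dots> = inv h' \<otimes> (h' \<otimes> k') \<otimes> inv k" by (simp only: eq)
    also have "\<dots> = k' \<otimes> inv k" using hk by (simp add: m_assoc[symmetric])
    finally have "inv h' \<otimes> h = k' \<otimes> inv k" .
    moreover have "inv h' \<otimes> h \<in> H"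
      using hk by (intro subgroup.m_closed[OF H] subgroup.m_inv_closed[OF H])
    moreover have "k' \<otimes> inv k \<in> K"
      using hk by (intro subgroup.m_closed[OF K] subgroup.m_inv_closed[OF K])
    ultimately have "inv h' \<otimes> h = \<one>"
      using coprime_subgroups_Int[OF H K cop, of "inv h' \<otimes> h"] by simp
    then have "inv h = inv h'" using hk by (intro inv_equality) simp_all
    then have "inv (inv h) = inv (inv h')" by (rule arg_cong)
    then have "h = h'" using hk by simp
    then show ?thesis using eq hk by simp
  qed
  have inj: "inj_on (\<lambda>(h, k). h \<otimes> k) (H \<times> K)"
    by (rule inj_onI) (use cancel in fastforce)
  have "H <#> K = (\<lambda>(h, k). h \<otimes> k) ` (H \<times> K)" by (auto simp: set_mult_def)
  then show ?thesis using card_image[OF inj] by (simp add: card_cartesian_product)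
qed

text \<open>Modulo \<open>H\<close> every element of \<open>H <#> P\<close> is an element of \<open>P\<close>.\<close>
lemma (in normal) pow_card_mem_normal:
  assumes P: "subgroup P G" and x: "x \<in> H <#> P"
  shows "x [^] card P \<in> H"
proof -
  obtain h p where hp: "h \<in> H" "p \<in> P" "x = h \<otimes> p" using x by (auto simp: set_mult_def)
  have hG: "h \<in> carrier G" using hp(1) subset by blast
  have pG: "p \<in> carrier G" using subgroup.mem_carrier[OF P hp(2)] .
  have xG: "x \<in> carrier G" using hp(3) hG pG by simp
  have p: "p [^] card P = \<one>" by (rule pow_card_subgroup[OF P hp(2)])
  have "H #> x = (H #> h) #> p" unfolding hp(3) by (rule coset_mult_assoc[OF subset hG pG, symmetric])
  then have "H #> x = H #> p" by (simp only: rcos_const[OF is_group hp(1)])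
  then have "H #> (x [^] card P) = H #> (p [^] card P)"
    using FactGroup_pow[OF xG, of "card P"] FactGroup_pow[OF pG, of "card P"] by metis
  also have "\<dots> = H" unfolding p by (rule coset_mult_one[OF subset])
  finally show ?thesis using xG by (intro coset_join1[OF _ _ subgroup_axioms]) simp_all
qed

lemma (in group) prime_dvd_order_imp_dvd_exponent:
  fixes q n :: nat
  assumes fin: "finite (carrier G)" and q: "Factorial_Ring.prime q" "q dvd order G"
    and pow: "\<And>x. x \<in> carrier G \<Longrightarrow> x [^] n = \<one>"
  shows "q dvd n"
proof -
  (* Sylow's theorem with exponent 1 yields a subgroup of order q, hence an element of order q. *)
  obtain m where m: "order G = q ^ 1 * m" using q(2) by auto
  obtain H where H: "subgroup H G" "card H = q"
    using sylow_thm[OF q(1) group_axioms m fin] by auto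
  interpret H: subgroup H G by (rule H(1))
  have "H \<noteq> {\<one>}" using H(2) q(1) by auto
  then obtain x where x: "x \<in> H" "x \<noteq> \<one>" using H.one_closed by blast
  have xG: "x \<in> carrier G" using x(1) by (rule H.mem_carrier)
  have "x [^] q = \<one>" using pow_card_subgroup[OF H(1) x(1)] by (simp add: H(2))
  then have "ord x dvd q" using pow_eq_id xG by blast
  moreover have "ord x \<noteq> 1" using x(2) xG ord_eq_1 by blast
  ultimately have "ord x = q" using q(1) by (metis prime_nat_iff)
  then show ?thesis using pow[OF xG] pow_eq_id xG by blast
qed

text \<open>This is Cauchy's theorem in the quotient by \<open>H\<close>; it bounds the primes dividing an index.\<close>
lemma (in normal) prime_dvd_index_imp_dvd_exponent:
  fixes q n :: nat
  assumes fin: "finite (carrier G)" and q: "Factorial_Ring.prime q" "q dvd card (rcosets H)"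
    and pow: "\<And>x. x \<in> carrier G \<Longrightarrow> x [^] n \<in> H"
  shows "q dvd n"
proof -
  interpret Q: group "G Mod H" by (rule factorgroup_is_group)
  show ?thesis
  proof (rule Q.prime_dvd_order_imp_dvd_exponent)
    show "finite (carrier (G Mod H))" "q dvd order (G Mod H)"
      using fin q(2) by (simp_all add: FactGroup_def RCOSETS_def order_def)
    fix X assume "X \<in> carrier (G Mod H)"
    then obtain x where x: "x \<in> carrier G" "X = H #> x" by (auto simp: FactGroup_def RCOSETS_def)
    have "X [^]\<^bsub>G Mod H\<^esub> n = H #> x [^] n" using FactGroup_pow[of x n] x normal_axioms by simp
    also have "\<dots> = H" using pow x(1) by (simp add: rcos_const)
    finally show "X [^]\<^bsub>G Mod H\<^esub> n = \<one>\<^bsub>G Mod H\<^esub>" by simp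
  qed (rule q)
qed

section \<open>Averages over index sets of coprime size\<close>

text \<open>
  In a finite abelian group \<open>G\<close> whose order is coprime to \<open>|I|\<close>, division by \<open>|I|\<close> is the power
  with exponent an inverse of \<open>|I|\<close> modulo \<open>|G|\<close>. Any such inverse serves; the choice does not
  affect the value.
\<close>
definition group_average :: "('a, 'b) monoid_scheme \<Rightarrow> 'i set \<Rightarrow> ('i \<Rightarrow> 'a) \<Rightarrow> 'a" where
  "group_average G I f = finprod G f I [^]\<^bsub>G\<^esub> (SOME k::nat. [card I * k = 1] (mod order G))"

context comm_group
begin

lemma group_average_closed: "f \<in> I \<rightarrow> carrier G \<Longrightarrow> group_average G I f \<in> carrier G"
  by (simp add: group_average_def)

lemma group_average_mult:
  assumes "f \<in> I \<rightarrow> carrier G" "h \<in> I \<rightarrow> carrier G"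
  shows "group_average G I (\<lambda>i. f i \<otimes> h i) = group_average G I f \<otimes> group_average G I h"
  using assms by (simp add: group_average_def nat_pow_distrib finprod_multf)

lemma group_average_const:
  assumes fin: "finite (carrier G)" and cop: "coprime (card I) (order G)" and m: "m \<in> carrier G"
  shows "group_average G I (\<lambda>_. m) = m"
proof -
  define k where "k = (SOME k::nat. [card I * k = 1] (mod order G))"
  have "\<exists>k. [card I * k = 1] (mod order G)"
    using cong_solve_coprime_nat[OF cop] by simp
  then have k: "[card I * k = 1] (mod order G)" unfolding k_def by (rule someI_ex)
  have pow_mod: "m [^] (j mod order G) = m [^] j" for j :: nat
  proof -
    have "m [^] j = m [^] (order G * (j div order G)) \<otimes> m [^] (j mod order G)"
      using m by (simp add: nat_pow_mult)
    also have "m [^] (order G * (j div order G)) = \<one>"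
      using m pow_order_eq_1[OF m] by (metis nat_pow_pow nat_pow_one)
    finally show ?thesis using m by simp
  qed
  have "m [^] (card I * k) = m [^] (1::nat)"
    using k pow_mod unfolding cong_def by metis
  then show ?thesis using m
    unfolding group_average_def k_def[symmetric] by (simp add: finprod_const nat_pow_pow)
qed

lemma group_average_reindex:
  assumes f: "f \<in> I \<rightarrow> carrier G" and bij: "bij_betw \<sigma> I I"
  shows "group_average G I (\<lambda>i. f (\<sigma> i)) = group_average G I f"
proof -
  have "finprod G f (\<sigma> ` I) = finprod G (\<lambda>i. f (\<sigma> i)) I"
    using bij f by (intro finprod_reindex) (auto simp: bij_betw_def)
  then show ?thesis using bij by (simp add: group_average_def bij_betw_def)
qed

lemma group_average_cong:
  assumes "f \<in> I \<rightarrow> carrier G" "\<And>i. i \<in> I \<Longrightarrow> f i = h i"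
  shows "group_average G I f = group_average G I h"
proof -
  have "finprod G f I = finprod G h I" using assms by (intro finprod_cong) (auto simp: simp_implies_def Pi_iff)
  then show ?thesis by (simp add: group_average_def)
qed

lemma group_average_hom:
  assumes f: "f \<in> I \<rightarrow> carrier G" and \<phi>: "\<phi> \<in> hom G G"
  shows "group_average G I (\<lambda>i. \<phi> (f i)) = \<phi> (group_average G I f)"
proof -
  interpret \<phi>: group_hom G G \<phi> by unfold_locales (rule \<phi>)
  have "finprod G (\<lambda>i. \<phi> (f i)) I = \<phi> (finprod G f I)"
  proof (cases "finite I")
    case True
    then show ?thesis using f
      by (induction I rule: finite_induct) (simp_all add: Pi_iff)
  qed simp
  then show ?thesis using f by (simp add: group_average_def \<phi>.hom_nat_pow)
qed

end

section \<open>Numbers with prescribed prime divisors\<close>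

lemma pi_number_mult: "\<lbrakk>pi_number \<pi> a; pi_number \<pi> b\<rbrakk> \<Longrightarrow> pi_number \<pi> (a * b)"
  by (auto simp: pi_number_def prime_dvd_mult_iff)

lemma pi_number_decompose:
  assumes "0 < (n::nat)"
  obtains r m where "n = r * m" "pi_number \<pi> r" "pi_number (- \<pi>) m"
proof -
  have "\<exists>r m. n = r * m \<and> pi_number \<pi> r \<and> pi_number (- \<pi>) m"
    using assms
  proof (induction n rule: less_induct)
    case (less n)
    show ?case
    proof (cases "n = 1")
      case True
      then show ?thesis by (intro exI[of _ 1]) (auto simp: pi_number_def)
    next
      case False
      then obtain q where q: "Factorial_Ring.prime q" "q dvd n" using prime_factor_nat by blast
      then obtain l where l: "n = q * l" by auto
      have "l < n" "0 < l" using l q(1) less.prems prime_gt_1_nat[OF q(1)] by auto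
      then obtain r m where rm: "l = r * m" "pi_number \<pi> r" "pi_number (- \<pi>) m"
        using less.IH by blast
      have q_pi: "pi_number \<rho> q" if "q \<in> \<rho>" for \<rho>
        using that q(1) by (auto simp: pi_number_def prime_gt_0_nat primes_dvd_imp_eq dest: primes_dvd_imp_eq)
      show ?thesis
      proof (cases "q \<in> \<pi>")
        case True
        then show ?thesis using rm l q_pi
          by (intro exI[of _ "q * r"] exI[of _ m]) (auto intro: pi_number_mult)
      next
        case False
        then show ?thesis using rm l q_pi
          by (intro exI[of _ r] exI[of _ "q * m"]) (auto intro: pi_number_mult)
      qed
    qed
  qed
  then show thesis using that by blast
qed

lemma pi_number_prime_power:
  assumes "Factorial_Ring.prime (p::nat)"
  shows "pi_number {p} (p ^ k)"
  using assms by (auto simp: pi_number_def prime_gt_0_nat dest: prime_dvd_power primes_dvd_imp_eq)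

lemma pi_number_singleton_le:
  assumes p: "Factorial_Ring.prime p" and d: "pi_number {p} d" "d dvd n" and n: "0 < n"
  shows "d \<le> p ^ multiplicity p n"
proof -
  have "d \<noteq> 0" "\<not> is_unit p" using d(1) p by (auto simp: pi_number_def)
  then obtain e where e: "d = p ^ multiplicity p d * e" "\<not> p dvd e"
    using multiplicity_decompose' by blast
  have "e = 1"
  proof (rule ccontr)
    assume "e \<noteq> 1"
    then obtain q where q: "Factorial_Ring.prime q" "q dvd e" using prime_factor_nat by blast
    then have "q dvd d" using e(1) by (metis dvd_mult)
    then have "q = p" using q(1) d(1) by (auto simp: pi_number_def)
    then show False using q(2) e(2) by simp
  qed
  moreover have "multiplicity p d \<le> multiplicity p n"
    using d(2) n by (intro dvd_imp_multiplicity_le) auto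
  ultimately show ?thesis using e(1) p prime_ge_1_nat by (metis mult.right_neutral power_increasing)
qed

section \<open>Additive words, the lambda action and ideals\<close>

context skew_brace
begin

text \<open>
  Together with associativity and \<open>-(x + y) = -y - x\<close> these cancellations bring every expression
  in the group \<open>(B, +)\<close> to reduced form, so that \<open>add_word\<close> decides identities between such expressions.
\<close>
lemma add_cancel_left:
  assumes "x \<in> carrier B" "y \<in> carrier B"
  shows "\<ominus> x \<oplus> (x \<oplus> y) = y" "x \<oplus> (\<ominus> x \<oplus> y) = y"
  using assms by (simp_all add: A.m_assoc[symmetric])

lemma add_cancel_middle:
  assumes "a \<oplus> x \<oplus> b = a \<oplus> y \<oplus> b" and [simp]: "a \<in> carrier B" "b \<in> carrier B"
    "x \<in> carrier B" "y \<in> carrier B"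
  shows "x = y"
proof -
  have "a \<oplus> x = a \<oplus> y" using assms(1) by simp
  then show ?thesis using add_cancel_left(1)[of a x] add_cancel_left(1)[of a y] by simp
qed

lemmas add_word = A.m_assoc A.inv_mult_group add_cancel_left

lemma lambda_closed [simp]:
  "\<lbrakk>a \<in> carrier B; b \<in> carrier B\<rbrakk> \<Longrightarrow> brace_lambda B a b \<in> carrier B"
  by (simp add: brace_lambda_def)

lemma lambda_add:
  assumes "c \<in> carrier B" "a \<in> carrier B" "b \<in> carrier B"
  shows "brace_lambda B c (a \<oplus> b) = brace_lambda B c a \<oplus> brace_lambda B c b"
  using assms by (simp add: brace_lambda_def brace a_minus_def add_word)

lemma add_conj_hom:
  "b \<in> carrier B \<Longrightarrow> (\<lambda>x. b \<oplus> x \<oplus> \<ominus> b) \<in> hom (add_monoid B) (add_monoid B)"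
  by (simp add: hom_def add_word)

lemma lambda_hom: "c \<in> carrier B \<Longrightarrow> brace_lambda B c \<in> hom (add_monoid B) (add_monoid B)"
  by (simp add: hom_def lambda_add)

lemma lambda_minus:
  assumes "c \<in> carrier B" "a \<in> carrier B"
  shows "brace_lambda B c (\<ominus> a) = \<ominus> brace_lambda B c a"
  using group_hom.hom_inv[of "add_monoid B" "add_monoid B" "brace_lambda B c" a] assms lambda_hom
  by (simp add: group_hom_def group_hom_axioms_def add_group a_inv_def)

lemma lambda_circ:
  assumes "a \<in> carrier B" "b \<in> carrier B" "x \<in> carrier B"
  shows "brace_lambda B (a \<otimes> b) x = brace_lambda B a (brace_lambda B b x)"
proof -
  have "brace_lambda B a (brace_lambda B b x) = brace_lambda B a (\<ominus> b) \<oplus> brace_lambda B a (b \<otimes> x)"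
    unfolding brace_lambda_def[of B b] using assms by (intro lambda_add) auto
  also have "\<dots> = \<ominus> (a \<otimes> b) \<oplus> (a \<otimes> (b \<otimes> x))"
    using assms by (simp add: lambda_minus) (simp add: brace_lambda_def add_word)
  finally show ?thesis using assms by (simp add: brace_lambda_def C.m_assoc)
qed

lemma lambda_one [simp]: "x \<in> carrier B \<Longrightarrow> brace_lambda B \<one> x = x"
  by (simp add: brace_lambda_def zero_eq_one[symmetric])

lemma lambda_inv_cancel:
  assumes "a \<in> carrier B" "x \<in> carrier B"
  shows "brace_lambda B a (brace_lambda B (inv\<^bsub>B\<^esub> a) x) = x"
  using lambda_circ[of a "inv\<^bsub>B\<^esub> a" x] assms by simp

text \<open>
  Multiplicative closure comes for free: \<open>a \<circ> b = a + \<lambda>\<^sub>a(b)\<close>, and the inverse of \<open>a\<close> in \<open>(B, \<circ>)\<close> is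
  \<open>-\<lambda>\<^sub>c(a)\<close> for \<open>c\<close> that inverse itself.
\<close>
lemma skew_brace_idealI:
  assumes add: "subgroup I (add_monoid B)"
    and add_conj: "\<And>c i. \<lbrakk>c \<in> carrier B; i \<in> I\<rbrakk> \<Longrightarrow> c \<oplus> i \<oplus> \<ominus> c \<in> I"
    and lam: "\<And>c i. \<lbrakk>c \<in> carrier B; i \<in> I\<rbrakk> \<Longrightarrow> brace_lambda B c i \<in> I"
    and conj: "\<And>c i. \<lbrakk>c \<in> carrier B; i \<in> I\<rbrakk> \<Longrightarrow> inv\<^bsub>B\<^esub> c \<otimes> i \<otimes> c \<in> I"
  shows "skew_brace_ideal I B"
proof -
  interpret I: subgroup I "add_monoid B"
    rewrites "carrier (add_monoid B) = carrier B"
      and "monoid.mult (add_monoid B) = ring.add B"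
      and "monoid.one (add_monoid B) = ring.zero B"
      and "m_inv (add_monoid B) = a_inv B"
    using add by (simp_all add: a_inv_def)
  have "I \<lhd> add_monoid B"
    using add add_conj by (intro group.normal_invI[OF add_group]) (auto simp: a_inv_def)
  moreover have "subgroup I B"
  proof (rule C.subgroupI)
    show "I \<subseteq> carrier B" "I \<noteq> {}" using I.subset I.one_closed by blast+
  next
    fix a assume a: "a \<in> I"
    have "brace_lambda B (inv\<^bsub>B\<^esub> a) a = \<ominus> (inv\<^bsub>B\<^esub> a)"
      using a by (simp add: brace_lambda_def zero_eq_one[symmetric])
    then have "\<ominus> (inv\<^bsub>B\<^esub> a) \<in> I" using a lam[of "inv\<^bsub>B\<^esub> a" a] by simp
    then have "\<ominus> (\<ominus> (inv\<^bsub>B\<^esub> a)) \<in> I" by (rule I.m_inv_closed)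
    then show "inv\<^bsub>B\<^esub> a \<in> I" using a by simp
  next
    fix a b assume "a \<in> I" "b \<in> I"
    then show "a \<otimes> b \<in> I" using lam by (simp add: circ_eq)
  qed
  then have "I \<lhd> B"
  proof (rule C.normal_invI)
    fix x h assume "x \<in> carrier B" "h \<in> I"
    then show "x \<otimes> h \<otimes> inv\<^bsub>B\<^esub> x \<in> I" using conj[of "inv\<^bsub>B\<^esub> x" h] by simp
  qed
  ultimately show ?thesis using lam by (auto simp: skew_brace_ideal_def)
qed

lemma ideal_sub_skew_brace: "skew_brace_ideal I B \<Longrightarrow> sub_skew_brace I B"
  by (simp add: skew_brace_ideal_def sub_skew_brace_def normal_imp_subgroup)

lemma ideal_add_conj:
  assumes "skew_brace_ideal I B" "c \<in> carrier B" "i \<in> I"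
  shows "c \<oplus> i \<oplus> \<ominus> c \<in> I"
  using assms normal.inv_op_closed2[of I "add_monoid B" c i]
  by (simp add: skew_brace_ideal_def a_inv_def)

lemma ideal_lambda:
  assumes "skew_brace_ideal I B" "c \<in> carrier B" "i \<in> I"
  shows "brace_lambda B c i \<in> I"
  using assms by (auto simp: skew_brace_ideal_def)

lemma ideal_conj:
  assumes "skew_brace_ideal I B" "c \<in> carrier B" "i \<in> I"
  shows "inv\<^bsub>B\<^esub> c \<otimes> i \<otimes> c \<in> I"
  using assms normal.inv_op_closed1[of I B c i]
  by (simp add: skew_brace_ideal_def)

lemma ideal_Int:
  assumes "skew_brace_ideal I B" "skew_brace_ideal J B"
  shows "skew_brace_ideal (I \<inter> J) B"
  unfolding skew_brace_ideal_def
proof (intro conjI ballI)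
  show "I \<inter> J \<lhd> add_monoid B" "I \<inter> J \<lhd> B"
    using assms by (auto simp: skew_brace_ideal_def
        intro: group.normal_subgroup_intersect[OF add_group] C.normal_subgroup_intersect)
  show "brace_lambda B c ` (I \<inter> J) \<subseteq> I \<inter> J" if "c \<in> carrier B" for c
    using ideal_lambda[OF assms(1) that] ideal_lambda[OF assms(2) that] by auto
qed

text \<open>
  A multiplicative subgroup containing an ideal \<open>I\<close> is a union of cosets of \<open>I\<close>, and these are the same for
  both operations; so additive closure may be checked modulo \<open>I\<close>.
\<close>
lemma add_subgroup_if_mod_ideal:
  assumes fin: "finite (carrier B)" and I: "skew_brace_ideal I B" and H: "subgroup H B" "I \<subseteq> H"
    and op: "\<And>a b. \<lbrakk>a \<in> H; b \<in> H\<rbrakk> \<Longrightarrow> \<exists>h\<in>H. I +> (a \<oplus> b) = I +> h"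
  shows "subgroup H (add_monoid B)"
proof (rule group.finite_closed_imp_subgroup[OF add_group])
  interpret H: subgroup H B by (rule H(1))
  show "finite H" using fin H.subset finite_subset by blast
  show "H \<subseteq> carrier (add_monoid B)" using H.subset by simp
  show "H \<noteq> {}" using H.one_closed by blast
  fix a b assume ab: "a \<in> H" "b \<in> H"
  then obtain h where h: "h \<in> H" "I +> (a \<oplus> b) = I +> h" using op[OF ab] by blast
  have "a \<oplus> b \<in> I +> (a \<oplus> b)"
    using ab A.rcos_self[of "a \<oplus> b" I] ideal_sub_skew_brace[OF I]
    by (simp add: sub_skew_brace_def a_r_coset_def)
  then have "a \<oplus> b \<in> I #> h" unfolding h(2) cosets_eq[OF I H.mem_carrier[OF h(1)]] .
  then obtain i where "i \<in> I" "a \<oplus> b = i \<otimes> h" by (auto simp: r_coset_def)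
  then have "a \<oplus> b \<in> H" using H(2) h(1) by auto
  then show "a \<otimes>\<^bsub>add_monoid B\<^esub> b \<in> H" by simp
qed

lemma coset_eq_if_diff_mem:
  assumes "skew_brace_ideal I B" and "x \<in> carrier B" "y \<in> carrier B" and "x \<oplus> \<ominus> y \<in> I"
  shows "I +> x = I +> y"
proof -
  have sub: "subgroup I (add_monoid B)"
    using ideal_sub_skew_brace[OF assms(1)] by (simp add: sub_skew_brace_def)
  have "x = (x \<oplus> \<ominus> y) \<oplus> y" using assms by (simp add: add_word)
  then have "x \<in> I #>\<^bsub>add_monoid B\<^esub> y"
    unfolding r_coset_def using assms(4) by (intro UN_I[of "x \<oplus> \<ominus> y"]) simp_all
  then show ?thesis using A.repr_independence[of x I y] sub assms by (simp add: a_r_coset_def)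
qed

lemma subgroup_mult_ideal:
  assumes I: "skew_brace_ideal I B" and P: "subgroup P B"
  shows "subgroup (I <#> P) B" "I \<subseteq> I <#> P" "P \<subseteq> I <#> P"
proof -
  interpret I: normal I B using I by (simp add: skew_brace_ideal_def)
  interpret P: subgroup P B by (rule P)
  show "subgroup (I <#> P) B" by (rule C.mult_norm_subgroup[OF I.normal_axioms P])
  show "I \<subseteq> I <#> P"
  proof
    fix i assume "i \<in> I"
    then have "i = i \<otimes> \<one>" by simp
    then show "i \<in> I <#> P" using \<open>i \<in> I\<close> P.one_closed unfolding set_mult_def by blast
  qed
  show "P \<subseteq> I <#> P"
  proof
    fix p assume "p \<in> P"
    then have "p = \<one> \<otimes> p" by simp
    then show "p \<in> I <#> P" using \<open>p \<in> P\<close> I.one_closed unfolding set_mult_def by blast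
  qed
qed

end

section \<open>Conjugation and the star identity in two-sided skew braces\<close>

context two_sided_skew_brace
begin

text \<open>
  The right brace law turns \<open>(a + b) \<circ> c\<close> into \<open>a \<circ> c - c + b \<circ> c\<close>; on multiplying from the left by the
  inverse \<open>d\<close> of \<open>c\<close>, the left brace law produces correction terms that cancel because \<open>\<lambda>\<^sub>d(c) = -d\<close>.
\<close>
lemma conj_add:
  assumes [simp]: "c \<in> carrier B" "a \<in> carrier B" "b \<in> carrier B"
  shows "inv\<^bsub>B\<^esub> c \<otimes> (a \<oplus> b) \<otimes> c = (inv\<^bsub>B\<^esub> c \<otimes> a \<otimes> c) \<oplus> (inv\<^bsub>B\<^esub> c \<otimes> b \<otimes> c)"
proof -
  let ?d = "inv\<^bsub>B\<^esub> c"
  have lm: "brace_lambda B ?d (a \<otimes> c \<oplus> \<ominus> c \<oplus> b \<otimes> c) =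
      brace_lambda B ?d (a \<otimes> c) \<oplus> \<ominus> brace_lambda B ?d c \<oplus> brace_lambda B ?d (b \<otimes> c)"
    by (simp add: lambda_add lambda_minus)
  have dc: "brace_lambda B ?d c = \<ominus> ?d"
    by (simp add: brace_lambda_def zero_eq_one[symmetric])
  have "?d \<otimes> (a \<oplus> b) \<otimes> c = ?d \<otimes> (a \<otimes> c \<oplus> \<ominus> c \<oplus> b \<otimes> c)"
    by (simp add: C.m_assoc right_brace a_minus_def)
  also have "\<dots> = ?d \<oplus> brace_lambda B ?d (a \<otimes> c \<oplus> \<ominus> c \<oplus> b \<otimes> c)"
    by (rule circ_eq) simp_all
  also have "\<dots> = (?d \<otimes> a \<otimes> c) \<oplus> (?d \<otimes> b \<otimes> c)"
    unfolding lm dc by (simp add: brace_lambda_def add_word C.m_assoc)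
  finally show ?thesis .
qed

lemma conj_hom:
  "c \<in> carrier B \<Longrightarrow> (\<lambda>x. inv\<^bsub>B\<^esub> c \<otimes> x \<otimes> c) \<in> hom (add_monoid B) (add_monoid B)"
  by (simp add: hom_def conj_add)

lemma conj_minus:
  assumes "c \<in> carrier B" "a \<in> carrier B"
  shows "inv\<^bsub>B\<^esub> c \<otimes> (\<ominus> a) \<otimes> c = \<ominus> (inv\<^bsub>B\<^esub> c \<otimes> a \<otimes> c)"
  using group_hom.hom_inv[of "add_monoid B" "add_monoid B" "\<lambda>x. inv\<^bsub>B\<^esub> c \<otimes> x \<otimes> c" a] assms conj_hom
  by (simp add: group_hom_def group_hom_axioms_def add_group a_inv_def)

text \<open>
  The two brace laws expand \<open>(a + b) \<circ> (c + d)\<close> into words that both start with \<open>a \<circ> c\<close> and end with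
  \<open>b \<circ> d\<close>, and whose middle parts are the two sides below.
\<close>
lemma star_commute:
  assumes [simp]: "a \<in> carrier B" "b \<in> carrier B" "c \<in> carrier B" "d \<in> carrier B"
  shows "(\<ominus> c \<oplus> b \<otimes> c \<oplus> \<ominus> b) \<oplus> (\<ominus> a \<oplus> a \<otimes> d \<oplus> \<ominus> d) =
     (\<ominus> a \<oplus> a \<otimes> d \<oplus> \<ominus> d) \<oplus> (\<ominus> c \<oplus> b \<otimes> c \<oplus> \<ominus> b)" (is "?y \<oplus> ?x = ?x \<oplus> ?y")
proof -
  have left: "(a \<oplus> b) \<otimes> (c \<oplus> d) = a \<otimes> c \<oplus> (?y \<oplus> ?x) \<oplus> b \<otimes> d"
    using brace[of "a \<oplus> b" c d] by (simp add: right_brace a_minus_def add_word)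
  have right: "(a \<oplus> b) \<otimes> (c \<oplus> d) = a \<otimes> c \<oplus> (?x \<oplus> ?y) \<oplus> b \<otimes> d"
    using right_brace[of "c \<oplus> d" a b] by (simp add: brace a_minus_def add_word)
  show ?thesis by (rule add_cancel_middle[OF left[unfolded right, symmetric]]) simp_all
qed

end

section \<open>A complement of an abelian ideal of coprime order\<close>

text \<open>
  By coprimality \<open>P\<close> is a transversal of the cosets of \<open>M\<close> in \<open>M \<circ> P\<close>. That \<open>M \<circ> P\<close> is an additive subgroup
  is what allows sums of elements of \<open>P\<close> to be compared with \<open>P\<close> modulo \<open>M\<close>.
\<close>
locale coprime_abelian_ideal = two_sided_skew_brace +
  fixes M P :: "'a set"
  assumes fin: "finite (carrier B)"
    and ideal: "skew_brace_ideal M B"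
    and M_comm: "\<lbrakk>x \<in> M; y \<in> M\<rbrakk> \<Longrightarrow> x \<oplus> y = y \<oplus> x"
    and P_subgroup: "subgroup P B"
    and coprime: "coprime (card P) (card M)"
    and MP_add_subgroup: "subgroup (M <#> P) (add_monoid B)"
begin

lemma M_subgroup: "subgroup M (add_monoid B)" "subgroup M B"
  using ideal ideal_sub_skew_brace by (auto simp: sub_skew_brace_def)

lemma M_carrier [simp]: "x \<in> M \<Longrightarrow> x \<in> carrier B"
  using M_subgroup(2) by (rule subgroup.mem_carrier)

lemma P_carrier [simp]: "x \<in> P \<Longrightarrow> x \<in> carrier B"
  using P_subgroup by (rule subgroup.mem_carrier)

lemma P_circ_closed [simp]: "\<lbrakk>x \<in> P; y \<in> P\<rbrakk> \<Longrightarrow> x \<otimes> y \<in> P"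
  using P_subgroup by (rule subgroup.m_closed)

lemma P_inv_closed [simp]: "x \<in> P \<Longrightarrow> inv\<^bsub>B\<^esub> x \<in> P"
  using P_subgroup by (rule subgroup.m_inv_closed)

lemma finite_M: "finite M" and finite_P: "finite P"
  using fin finite_subset[of _ "carrier B"] by (auto simp: subset_iff)

sublocale N: comm_group "(add_monoid B)\<lparr>carrier := M\<rparr>"
  rewrites "carrier ((add_monoid B)\<lparr>carrier := M\<rparr>) = M"
    and "monoid.mult ((add_monoid B)\<lparr>carrier := M\<rparr>) = ring.add B"
proof -
  have "group ((add_monoid B)\<lparr>carrier := M\<rparr>)"
    by (rule subgroup.subgroup_is_group[OF M_subgroup(1) add_group])
  then show "comm_group ((add_monoid B)\<lparr>carrier := M\<rparr>)"
    by (rule group.group_comm_groupI) (simp add: M_comm)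
qed simp_all

text \<open>
  Congruences modulo \<open>M\<close> are handled as equations between cosets, that is, by computing in the quotient
  skew brace.
\<close>
sublocale Q: skew_brace "B Quot M"
  by (rule skew_brace_quot[OF ideal])

lemma coset_closed [simp]: "x \<in> carrier B \<Longrightarrow> M +> x \<in> carrier (B Quot M)"
  by (auto simp: FactRing_def A_RCOSETS_def RCOSETS_def a_r_coset_def)

lemma coset_zero: "M +> \<zero> = \<zero>\<^bsub>B Quot M\<^esub>"
  using A.coset_mult_one[of M] by (simp add: FactRing_def a_r_coset_def subset_iff)

lemma coset_add:
  "\<lbrakk>x \<in> carrier B; y \<in> carrier B\<rbrakk> \<Longrightarrow> M +> (x \<oplus> y) = (M +> x) \<oplus>\<^bsub>B Quot M\<^esub> (M +> y)"
  by (simp add: quot_add[OF ideal])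

lemma coset_circ:
  "\<lbrakk>x \<in> carrier B; y \<in> carrier B\<rbrakk> \<Longrightarrow> M +> (x \<otimes> y) = (M +> x) \<otimes>\<^bsub>B Quot M\<^esub> (M +> y)"
  by (simp add: quot_mult[OF ideal])

lemma coset_minus:
  assumes "x \<in> carrier B"
  shows "M +> (\<ominus> x) = \<ominus>\<^bsub>B Quot M\<^esub> (M +> x)"
proof -
  have "(M +> (\<ominus> x)) \<oplus>\<^bsub>B Quot M\<^esub> (M +> x) = \<zero>\<^bsub>B Quot M\<^esub>"
    using assms by (simp add: coset_zero flip: coset_add)
  then show ?thesis using assms by (intro Q.A.inv_equality[symmetric]) simp_all
qed

lemma mem_M_iff: "x \<in> carrier B \<Longrightarrow> x \<in> M \<longleftrightarrow> M +> x = \<zero>\<^bsub>B Quot M\<^esub>"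
  using A.coset_join1[of M x] A.coset_join2[of x M] M_subgroup(1)
  by (auto simp: FactRing_def a_r_coset_def subset_iff)

lemmas coset_simps = coset_zero coset_add coset_circ coset_minus

lemma M_Int_P: "\<lbrakk>x \<in> M; x \<in> P\<rbrakk> \<Longrightarrow> x = \<one>"
  using C.coprime_subgroups_Int[OF P_subgroup M_subgroup(2) coprime] by blast

lemma P_eqI:
  assumes "a \<in> P" "b \<in> P" "M +> a = M +> b"
  shows "a = b"
proof -
  have "M +> (a \<otimes> inv\<^bsub>B\<^esub> b) = M +> (b \<otimes> inv\<^bsub>B\<^esub> b)"
    using assms by (simp only: coset_circ P_carrier P_inv_closed)
  also have "\<dots> = \<zero>\<^bsub>B Quot M\<^esub>" using assms by (simp add: coset_zero flip: zero_eq_one)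
  finally have "a \<otimes> inv\<^bsub>B\<^esub> b \<in> M" using assms by (subst mem_M_iff) auto
  then have "a \<otimes> inv\<^bsub>B\<^esub> b = \<one>" using assms by (intro M_Int_P) auto
  then show ?thesis using assms C.inv_equality[of a "inv\<^bsub>B\<^esub> b"] by simp
qed

definition rep :: "'a \<Rightarrow> 'a" where
  "rep x = (SOME p. p \<in> P \<and> M +> p = M +> x)"

lemma
  assumes "x \<in> M <#> P"
  shows rep_closed: "rep x \<in> P" and coset_rep: "M +> rep x = M +> x"
proof -
  obtain m p where mp: "m \<in> M" "p \<in> P" "x = m \<otimes> p" using assms by (auto simp: set_mult_def)
  then have "M +> x = M +> p"
    using mem_M_iff[of m] by (simp add: coset_circ Q.zero_eq_one)
  then have "\<exists>p. p \<in> P \<and> M +> p = M +> x" using mp by auto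
  then have "rep x \<in> P \<and> M +> rep x = M +> x" unfolding rep_def by (rule someI_ex)
  then show "rep x \<in> P" "M +> rep x = M +> x" by auto
qed

lemma P_MP [simp]: "p \<in> P \<Longrightarrow> p \<in> M <#> P"
  using subgroup.one_closed[OF M_subgroup(2)] by (force simp: set_mult_def)

lemma MP_add_closed [simp]: "\<lbrakk>x \<in> M <#> P; y \<in> M <#> P\<rbrakk> \<Longrightarrow> x \<oplus> y \<in> M <#> P"
  using subgroup.m_closed[OF MP_add_subgroup] by simp

lemma MP_minus_closed [simp]: "x \<in> M <#> P \<Longrightarrow> \<ominus> x \<in> M <#> P"
  using subgroup.m_inv_closed[OF MP_add_subgroup] by (simp add: a_inv_def)

lemma rep_carrier [simp]: "x \<in> M <#> P \<Longrightarrow> rep x \<in> carrier B"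
  by (simp add: rep_closed)

lemma bij_betw_P:
  assumes "\<And>p. p \<in> P \<Longrightarrow> \<sigma> p \<in> P" "inj_on \<sigma> P"
  shows "bij_betw \<sigma> P P"
  using assms finite_P endo_inj_surj[of P \<sigma>] by (auto simp: bij_betw_def)

text \<open>Averages over \<open>P\<close> will be reindexed along these translations of the transversal \<open>P\<close>.\<close>
lemma bij_rep_add:
  assumes a: "a \<in> M <#> P" and b: "\<And>p. p \<in> P \<Longrightarrow> \<sigma> p \<in> P" "inj_on \<sigma> P"
  shows "bij_betw (\<lambda>p. rep (a \<oplus> \<sigma> p)) P P"
proof (rule bij_betw_P)
  have aB [simp]: "a \<in> carrier B" using subgroup.mem_carrier[OF MP_add_subgroup a] by simp
  show "inj_on (\<lambda>p. rep (a \<oplus> \<sigma> p)) P"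
  proof (rule inj_onI)
    fix p q assume pq: "p \<in> P" "q \<in> P" "rep (a \<oplus> \<sigma> p) = rep (a \<oplus> \<sigma> q)"
    then have "M +> (a \<oplus> \<sigma> p) = M +> (a \<oplus> \<sigma> q)"
      using a b coset_rep[of "a \<oplus> \<sigma> p"] coset_rep[of "a \<oplus> \<sigma> q"] by simp
    then have "(M +> a) \<oplus>\<^bsub>B Quot M\<^esub> (M +> \<sigma> p) = (M +> a) \<oplus>\<^bsub>B Quot M\<^esub> (M +> \<sigma> q)"
      using pq b by (simp add: coset_add)
    then have "M +> \<sigma> p = M +> \<sigma> q"
      using pq b Q.add_cancel_left(1)[of "M +> a"] by (metis aB P_carrier coset_closed)
    then show "p = q" using pq b P_eqI by (meson inj_onD)
  qed
qed (use a b in \<open>simp add: rep_closed\<close>)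

text \<open>
  With \<open>u = rep (y + b)\<close>, the factor set of the additive extension of \<open>(M \<circ> P)/M\<close> by \<open>M\<close>, for the transversal \<open>P\<close>,
  is \<open>f(y, b) = y + b - u\<close>. The defect is its conjugate \<open>-y + f(y, b) + y\<close>, for which the action of \<open>\<lambda>\<close>
  takes a simpler form (\<open>lambda_defect\<close>). It vanishes exactly when \<open>y + b\<close> is in \<open>P\<close>.
\<close>
definition defect :: "'a \<Rightarrow> 'a \<Rightarrow> 'a" where
  "defect y b = b \<oplus> \<ominus> rep (y \<oplus> b) \<oplus> y"

lemma defect_closed [simp]:
  assumes "y \<in> P" "b \<in> P"
  shows "defect y b \<in> M"
proof -
  have "M +> defect y b = \<zero>\<^bsub>B Quot M\<^esub>"
    using assms by (simp add: defect_def coset_simps coset_rep Q.add_word)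
  then show ?thesis using assms by (subst mem_M_iff) (simp_all add: defect_def)
qed

text \<open>
  The 2-cocycle identity of a factor set. Both sides reduce to \<open>b + c - w + a\<close>, where \<open>w\<close> represents
  \<open>a + b + c\<close>, once the two terms on the left are swapped inside the abelian group \<open>M\<close>.
\<close>
lemma defect_cocycle:
  assumes [simp]: "a \<in> P" "b \<in> P" "c \<in> P"
  shows "defect a b \<oplus> (b \<oplus> defect (rep (a \<oplus> b)) c \<oplus> \<ominus> b) =
     (b \<oplus> defect b c \<oplus> \<ominus> b) \<oplus> defect a (rep (b \<oplus> c))"
proof -
  have [simp]: "rep (a \<oplus> b) \<in> P" "rep (b \<oplus> c) \<in> P" by (simp_all add: rep_closed)
  have w: "rep (rep (a \<oplus> b) \<oplus> c) = rep (a \<oplus> rep (b \<oplus> c))"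
    by (rule P_eqI) (simp_all add: rep_closed coset_rep coset_add Q.A.m_assoc)
  have "defect a b \<oplus> (b \<oplus> defect (rep (a \<oplus> b)) c \<oplus> \<ominus> b) =
      (b \<oplus> defect (rep (a \<oplus> b)) c \<oplus> \<ominus> b) \<oplus> defect a b"
    by (intro M_comm ideal_add_conj[OF ideal]) simp_all
  then show ?thesis
    by (simp add: defect_def w add_word)
qed

text \<open>
  By the left brace law \<open>c \<circ> rep (y + b)\<close> represents \<open>c \<circ> y - c + c \<circ> b\<close>. Choosing \<open>t\<close> to represent
  \<open>-c + c \<circ> b\<close> thus makes both \<open>c + t\<close> and \<open>c \<circ> y + t\<close> have known representatives, and the
  identity becomes one of words. The substitution \<open>b \<mapsto> t\<close> permutes \<open>P\<close>.
\<close>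
lemma lambda_defect:
  assumes [simp]: "c \<in> P" "y \<in> P" "b \<in> P"
  defines "t \<equiv> rep (\<ominus> c \<oplus> c \<otimes> b)"
  shows "defect c t \<oplus> brace_lambda B c (defect y b) = defect (c \<otimes> y) t"
proof -
  have [simp]: "t \<in> P" unfolding t_def by (simp add: rep_closed)
  have t: "M +> t = M +> (\<ominus> c \<oplus> c \<otimes> b)" unfolding t_def by (simp add: coset_rep)
  have [simp]: "rep (y \<oplus> b) \<in> P" by (simp add: rep_closed)
  have 1: "rep (c \<oplus> t) = c \<otimes> b"
    by (rule P_eqI) (simp_all add: rep_closed coset_rep coset_simps t Q.add_word)
  have 2: "rep (c \<otimes> y \<oplus> t) = c \<otimes> rep (y \<oplus> b)"
    by (rule P_eqI)
      (simp_all add: rep_closed coset_rep coset_simps t Q.add_word Q.brace a_minus_def)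
  have "brace_lambda B c (defect y b) =
      brace_lambda B c b \<oplus> \<ominus> brace_lambda B c (rep (y \<oplus> b)) \<oplus> brace_lambda B c y"
    by (simp add: defect_def lambda_add lambda_minus)
  then show ?thesis
    unfolding defect_def[of _ t] 1 2 by (simp add: brace_lambda_def add_word)
qed

text \<open>Conjugation by \<open>c\<close> is a skew brace automorphism that leaves \<open>M\<close> and \<open>P\<close> invariant.\<close>
lemma conj_defect:
  assumes [simp]: "c \<in> P" "y \<in> P" "b \<in> P"
  shows "inv\<^bsub>B\<^esub> c \<otimes> defect y b \<otimes> c = defect (inv\<^bsub>B\<^esub> c \<otimes> y \<otimes> c) (inv\<^bsub>B\<^esub> c \<otimes> b \<otimes> c)"
proof -
  have "rep ((inv\<^bsub>B\<^esub> c \<otimes> y \<otimes> c) \<oplus> (inv\<^bsub>B\<^esub> c \<otimes> b \<otimes> c)) = inv\<^bsub>B\<^esub> c \<otimes> rep (y \<oplus> b) \<otimes> c"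
  proof (rule P_eqI)
    show "inv\<^bsub>B\<^esub> c \<otimes> rep (y \<oplus> b) \<otimes> c \<in> P" by (simp add: rep_closed)
    have "M +> (inv\<^bsub>B\<^esub> c \<otimes> rep (y \<oplus> b) \<otimes> c) = M +> (inv\<^bsub>B\<^esub> c \<otimes> (y \<oplus> b) \<otimes> c)"
      by (simp add: coset_circ coset_rep)
    then show "M +> rep ((inv\<^bsub>B\<^esub> c \<otimes> y \<otimes> c) \<oplus> (inv\<^bsub>B\<^esub> c \<otimes> b \<otimes> c)) = M +> (inv\<^bsub>B\<^esub> c \<otimes> rep (y \<oplus> b) \<otimes> c)"
      by (simp add: coset_rep conj_add)
  qed (simp add: rep_closed)
  then show ?thesis by (simp add: defect_def conj_add conj_minus)
qed

definition avg :: "('a \<Rightarrow> 'a) \<Rightarrow> 'a" where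
  "avg = group_average ((add_monoid B)\<lparr>carrier := M\<rparr>) P"

lemma avg_const [simp]: "m \<in> M \<Longrightarrow> avg (\<lambda>_. m) = m"
  using N.group_average_const[of P m] finite_M coprime by (simp add: avg_def order_def)

lemma avg_closed: "f \<in> P \<rightarrow> M \<Longrightarrow> avg f \<in> M"
  unfolding avg_def by (rule N.group_average_closed)

lemma avg_add:
  "\<lbrakk>f \<in> P \<rightarrow> M; h \<in> P \<rightarrow> M\<rbrakk> \<Longrightarrow> avg (\<lambda>x. f x \<oplus> h x) = avg f \<oplus> avg h"
  unfolding avg_def by (rule N.group_average_mult)

lemma avg_reindex: "\<lbrakk>f \<in> P \<rightarrow> M; bij_betw \<sigma> P P\<rbrakk> \<Longrightarrow> avg (\<lambda>x. f (\<sigma> x)) = avg f"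
  unfolding avg_def by (rule N.group_average_reindex)

lemma avg_cong: "\<lbrakk>f \<in> P \<rightarrow> M; \<And>x. x \<in> P \<Longrightarrow> f x = h x\<rbrakk> \<Longrightarrow> avg f = avg h"
  unfolding avg_def by (rule N.group_average_cong)

lemma avg_hom:
  assumes "\<phi> \<in> hom (add_monoid B) (add_monoid B)" "\<And>m. m \<in> M \<Longrightarrow> \<phi> m \<in> M" "f \<in> P \<rightarrow> M"
  shows "avg (\<lambda>x. \<phi> (f x)) = \<phi> (avg f)"
  using assms unfolding avg_def by (intro N.group_average_hom) (auto simp: hom_def)

definition mean_defect :: "'a \<Rightarrow> 'a" where
  "mean_defect y = avg (defect y)"

lemma mean_defect_closed [simp]: "y \<in> P \<Longrightarrow> mean_defect y \<in> M"
  unfolding mean_defect_def by (rule avg_closed) simp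

text \<open>
  The identity \<open>defect_cocycle\<close> averaged over \<open>c\<close>: the representative of \<open>b + c\<close> runs through \<open>P\<close> together
  with \<open>c\<close>.
\<close>
lemma mean_defect_cocycle:
  assumes [simp]: "a \<in> P" "b \<in> P"
  shows "defect a b \<oplus> (b \<oplus> mean_defect (rep (a \<oplus> b)) \<oplus> \<ominus> b) =
     (b \<oplus> mean_defect b \<oplus> \<ominus> b) \<oplus> mean_defect a"
proof -
  have u [simp]: "rep (a \<oplus> b) \<in> P" by (simp add: rep_closed)
  have v [simp]: "rep (b \<oplus> c) \<in> P" if "c \<in> P" for c using that by (simp add: rep_closed)
  have conj: "b \<oplus> m \<oplus> \<ominus> b \<in> M" if "m \<in> M" for m
    using that by (intro ideal_add_conj[OF ideal]) simp_all
  have avg_conj: "avg (\<lambda>c. b \<oplus> defect y c \<oplus> \<ominus> b) = b \<oplus> mean_defect y \<oplus> \<ominus> b" if "y \<in> P" for y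
    unfolding mean_defect_def using that conj by (intro avg_hom add_conj_hom) auto
  have "avg (\<lambda>c. defect a (rep (b \<oplus> c))) = mean_defect a"
    unfolding mean_defect_def by (intro avg_reindex bij_rep_add) auto
  then have "(b \<oplus> mean_defect b \<oplus> \<ominus> b) \<oplus> mean_defect a =
      avg (\<lambda>c. (b \<oplus> defect b c \<oplus> \<ominus> b) \<oplus> defect a (rep (b \<oplus> c)))"
    using conj by (subst avg_add) (auto simp: avg_conj)
  also have "\<dots> = avg (\<lambda>c. defect a b \<oplus> (b \<oplus> defect (rep (a \<oplus> b)) c \<oplus> \<ominus> b))"
    using conj by (intro avg_cong) (auto simp: defect_cocycle)
  also have "\<dots> = defect a b \<oplus> (b \<oplus> mean_defect (rep (a \<oplus> b)) \<oplus> \<ominus> b)"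
    using conj by (subst avg_add) (auto simp: avg_conj)
  finally show ?thesis by simp
qed

text \<open>The identity \<open>lambda_defect\<close> averaged over \<open>b\<close>; it says that the mean defect is a 1-cocycle for \<open>\<lambda>\<close>.\<close>
lemma lambda_mean_defect:
  assumes [simp]: "c \<in> P" "y \<in> P"
  shows "mean_defect c \<oplus> brace_lambda B c (mean_defect y) = mean_defect (c \<otimes> y)"
proof -
  define \<tau> where "\<tau> b = rep (\<ominus> c \<oplus> c \<otimes> b)" for b
  have \<tau> [simp]: "\<tau> b \<in> P" if "b \<in> P" for b using that by (simp add: \<tau>_def rep_closed)
  have bij: "bij_betw \<tau> P P"
    unfolding \<tau>_def by (intro bij_rep_add inj_onI) simp_all
  have lam: "brace_lambda B c m \<in> M" if "m \<in> M" for m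
    using that by (intro ideal_lambda[OF ideal]) simp_all
  have re: "avg (\<lambda>b. defect y (\<tau> b)) = mean_defect y" if "y \<in> P" for y
    unfolding mean_defect_def using that by (intro avg_reindex[where f = "defect y"] bij) auto
  have "mean_defect (c \<otimes> y) = avg (\<lambda>b. defect c (\<tau> b) \<oplus> brace_lambda B c (defect y b))"
    unfolding re[symmetric, OF P_circ_closed[OF assms]]
    by (rule avg_cong) (simp_all add: lambda_defect[OF assms, folded \<tau>_def])
  also have "\<dots> = mean_defect c \<oplus> brace_lambda B c (mean_defect y)"
  proof -
    have "avg (\<lambda>b. brace_lambda B c (defect y b)) = brace_lambda B c (mean_defect y)"
      unfolding mean_defect_def by (rule avg_hom[OF lambda_hom]) (simp_all add: lam)
    then show ?thesis
      using avg_add[of "\<lambda>b. defect c (\<tau> b)" "\<lambda>b. brace_lambda B c (defect y b)"] by (simp add: re lam)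
  qed
  finally show ?thesis by simp
qed

lemma bij_conj: "c \<in> P \<Longrightarrow> bij_betw (\<lambda>x. inv\<^bsub>B\<^esub> c \<otimes> x \<otimes> c) P P"
  by (rule bij_betw_P) (auto intro: inj_onI)

lemma conj_mean_defect:
  assumes [simp]: "c \<in> P" "y \<in> P"
  shows "inv\<^bsub>B\<^esub> c \<otimes> mean_defect y \<otimes> c = mean_defect (inv\<^bsub>B\<^esub> c \<otimes> y \<otimes> c)"
proof -
  have conj: "inv\<^bsub>B\<^esub> c \<otimes> m \<otimes> c \<in> M" if "m \<in> M" for m
    using that by (intro ideal_conj[OF ideal]) simp_all
  have "inv\<^bsub>B\<^esub> c \<otimes> mean_defect y \<otimes> c = avg (\<lambda>b. inv\<^bsub>B\<^esub> c \<otimes> defect y b \<otimes> c)"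
    unfolding mean_defect_def by (rule avg_hom[OF conj_hom, symmetric]) (simp_all add: conj)
  also have "\<dots> = avg (\<lambda>b. defect (inv\<^bsub>B\<^esub> c \<otimes> y \<otimes> c) (inv\<^bsub>B\<^esub> c \<otimes> b \<otimes> c))"
    by (rule avg_cong) (simp_all add: conj conj_defect)
  also have "\<dots> = mean_defect (inv\<^bsub>B\<^esub> c \<otimes> y \<otimes> c)"
    unfolding mean_defect_def
    by (intro avg_reindex[where f = "defect (inv\<^bsub>B\<^esub> c \<otimes> y \<otimes> c)"] bij_conj) simp_all
  finally show ?thesis .
qed

text \<open>
  The 1-cocycle is the coboundary of its average \<open>s\<close>, and since \<open>s\<close> is invariant under conjugation by \<open>P\<close>,
  this coboundary measures the difference between the identity and the additive automorphism \<open>\<theta>\<close>. The cocycle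
  relation then says that \<open>\<theta>\<close> takes the same value at \<open>a + b\<close> and at its representative.
\<close>
lemma P_add_closed:
  assumes [simp]: "a \<in> P" "b \<in> P"
  shows "a \<oplus> b \<in> P"
proof -
  define s where "s = avg mean_defect"
  have s [simp]: "s \<in> M" unfolding s_def by (rule avg_closed) auto
  have lam_s: "mean_defect c \<oplus> brace_lambda B c s = s" if [simp]: "c \<in> P" for c
  proof -
    have lam: "brace_lambda B c m \<in> M" if "m \<in> M" for m
      using that by (intro ideal_lambda[OF ideal]) simp_all
    have "bij_betw (\<lambda>y. c \<otimes> y) P P"
      by (rule bij_betw_P) (auto intro: inj_onI)
    then have "s = avg (\<lambda>y. mean_defect (c \<otimes> y))"
      unfolding s_def by (intro avg_reindex[where f = mean_defect, symmetric]) simp_all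
    also have "\<dots> = avg (\<lambda>y. mean_defect c \<oplus> brace_lambda B c (mean_defect y))"
      by (rule avg_cong) (simp_all add: lambda_mean_defect)
    also have "\<dots> = mean_defect c \<oplus> avg (\<lambda>y. brace_lambda B c (mean_defect y))"
      using avg_add[of "\<lambda>_. mean_defect c" "\<lambda>y. brace_lambda B c (mean_defect y)"]
      by (simp add: lam)
    also have "avg (\<lambda>y. brace_lambda B c (mean_defect y)) = brace_lambda B c s"
      unfolding s_def by (rule avg_hom[OF lambda_hom]) (simp_all add: lam)
    finally show ?thesis by (rule sym)
  qed
  have comm_s: "s \<otimes> c = c \<otimes> s" if [simp]: "c \<in> P" for c
  proof -
    have conj: "inv\<^bsub>B\<^esub> c \<otimes> m \<otimes> c \<in> M" if "m \<in> M" for m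
      using that by (intro ideal_conj[OF ideal]) simp_all
    have "inv\<^bsub>B\<^esub> c \<otimes> s \<otimes> c = avg (\<lambda>y. inv\<^bsub>B\<^esub> c \<otimes> mean_defect y \<otimes> c)"
      unfolding s_def by (rule avg_hom[OF conj_hom, symmetric]) (simp_all add: conj)
    also have "\<dots> = avg (\<lambda>y. mean_defect (inv\<^bsub>B\<^esub> c \<otimes> y \<otimes> c))"
      by (rule avg_cong) (simp_all add: conj conj_mean_defect)
    also have "\<dots> = s"
      unfolding s_def by (intro avg_reindex[where f = mean_defect] bij_conj) simp_all
    finally have "c \<otimes> (inv\<^bsub>B\<^esub> c \<otimes> s \<otimes> c) = c \<otimes> s" by simp
    then show ?thesis by (simp add: C.m_assoc[symmetric])
  qed
  define \<theta> where "\<theta> x = s \<oplus> brace_lambda B s x \<oplus> \<ominus> s" for x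
  have \<theta>_closed [simp]: "\<theta> x \<in> carrier B" if "x \<in> carrier B" for x using that by (simp add: \<theta>_def)
  have \<theta>_add: "\<theta> (x \<oplus> y) = \<theta> x \<oplus> \<theta> y" if "x \<in> carrier B" "y \<in> carrier B" for x y
    using that by (simp add: \<theta>_def lambda_add add_word)
  have \<theta>_inj: "x = y" if "\<theta> x = \<theta> y" and [simp]: "x \<in> carrier B" "y \<in> carrier B" for x y
  proof -
    have "s \<otimes> x = s \<otimes> y" using that(1) by (simp add: \<theta>_def circ_eq)
    then show ?thesis by simp
  qed
  (* Here c \<circ> s = s \<circ> c reads c + \<lambda>\<^sub>c(s) = s + \<lambda>\<^sub>s(c), which eliminates \<lambda>\<^sub>c(s) from G(c) = s - \<lambda>\<^sub>c(s). *)
  have mean: "mean_defect c = \<ominus> \<theta> c \<oplus> c" if [simp]: "c \<in> P" for c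
  proof -
    have "c \<oplus> brace_lambda B c s = s \<oplus> brace_lambda B s c"
      using comm_s[of c] by (simp add: circ_eq)
    then have "brace_lambda B c s = \<ominus> c \<oplus> (s \<oplus> brace_lambda B s c)"
      using add_cancel_left(1)[of c "brace_lambda B c s"] by simp
    moreover have "mean_defect c = s \<oplus> \<ominus> brace_lambda B c s"
      using lam_s[of c] by (metis A.inv_solve_right M_carrier P_carrier lambda_closed mean_defect_closed s that)
    ultimately show ?thesis by (simp add: \<theta>_def add_word)
  qed
  define u where "u = rep (a \<oplus> b)"
  have u [simp]: "u \<in> P" unfolding u_def by (simp add: rep_closed)
  have "(b \<oplus> mean_defect u \<oplus> \<ominus> b) \<oplus> defect a b = defect a b \<oplus> (b \<oplus> mean_defect u \<oplus> \<ominus> b)"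
    by (intro M_comm ideal_add_conj[OF ideal]) simp_all
  also have "\<dots> = (b \<oplus> mean_defect b \<oplus> \<ominus> b) \<oplus> mean_defect a"
    unfolding u_def by (rule mean_defect_cocycle) simp_all
  finally have "b \<oplus> \<ominus> \<theta> u \<oplus> a = b \<oplus> \<ominus> \<theta> (a \<oplus> b) \<oplus> a"
    by (simp add: mean defect_def u_def[symmetric] \<theta>_add add_word)
  then have "\<ominus> \<theta> u = \<ominus> \<theta> (a \<oplus> b)" by (rule add_cancel_middle) simp_all
  then have "\<ominus> (\<ominus> \<theta> u) = \<ominus> (\<ominus> \<theta> (a \<oplus> b))" by (rule arg_cong)
  then have "\<theta> u = \<theta> (a \<oplus> b)" by simp
  then have "u = a \<oplus> b" by (rule \<theta>_inj) simp_all
  then show ?thesis using u by simp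
qed

end

section \<open>Centralizers as ideals\<close>

context skew_brace
begin

definition add_centralizer :: "'a set \<Rightarrow> 'a set" where
  "add_centralizer T = {x \<in> carrier B. \<forall>t\<in>T. x \<oplus> t = t \<oplus> x}"

lemma add_centralizer_subgroup:
  assumes "T \<subseteq> carrier B"
  shows "subgroup (add_centralizer T) (add_monoid B)"
proof (rule group.subgroupI[OF add_group])
  show "add_centralizer T \<noteq> {}" using assms by (auto simp: add_centralizer_def intro!: exI[of _ \<zero>])
  fix a assume a: "a \<in> add_centralizer T"
  have "\<ominus> a \<oplus> t = t \<oplus> \<ominus> a" if "t \<in> T" for t
  proof -
    have [simp]: "a \<in> carrier B" "t \<in> carrier B" using a that assms by (auto simp: add_centralizer_def)
    have "a \<oplus> (\<ominus> a \<oplus> t) \<oplus> a = a \<oplus> (t \<oplus> \<ominus> a) \<oplus> a"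
      using a that by (simp add: add_centralizer_def add_word)
    then show ?thesis by (rule add_cancel_middle) simp_all
  qed
  then show "inv\<^bsub>add_monoid B\<^esub> a \<in> add_centralizer T"
    using a by (simp add: add_centralizer_def flip: a_inv_def)
next
  fix a b assume a: "a \<in> add_centralizer T" and b: "b \<in> add_centralizer T"
  have "a \<oplus> b \<oplus> t = t \<oplus> (a \<oplus> b)" if "t \<in> T" for t
  proof -
    have [simp]: "a \<in> carrier B" "b \<in> carrier B" "t \<in> carrier B"
      using a b that assms by (auto simp: add_centralizer_def)
    have "a \<oplus> b \<oplus> t = a \<oplus> t \<oplus> b" using b that by (simp add: A.m_assoc add_centralizer_def)
    also have "\<dots> = t \<oplus> (a \<oplus> b)" using a that by (simp add: A.m_assoc add_centralizer_def)
    finally show ?thesis .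
  qed
  then show "a \<otimes>\<^bsub>add_monoid B\<^esub> b \<in> add_centralizer T"
    using a b by (simp add: add_centralizer_def)
qed (auto simp: add_centralizer_def)

lemma add_centralizer_diff:
  assumes "T \<subseteq> carrier B" "x \<in> add_centralizer T" "y \<in> add_centralizer T"
  shows "\<ominus> x \<oplus> y \<in> add_centralizer T" "x \<oplus> \<ominus> y \<in> add_centralizer T"
proof -
  interpret T: subgroup "add_centralizer T" "add_monoid B"
    rewrites "monoid.mult (add_monoid B) = ring.add B" and "m_inv (add_monoid B) = a_inv B"
    using add_centralizer_subgroup[OF assms(1)] by (simp_all add: a_inv_def)
  show "\<ominus> x \<oplus> y \<in> add_centralizer T" "x \<oplus> \<ominus> y \<in> add_centralizer T"
    using assms by auto
qed

lemma add_double_centralizer: "T \<subseteq> carrier B \<Longrightarrow> T \<subseteq> add_centralizer (add_centralizer T)"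
  by (auto simp: add_centralizer_def subset_iff)

end

context two_sided_skew_brace
begin

text \<open>
  If \<open>y\<close> centralizes \<open>T\<close> and \<open>\<phi>\<close> is one of the additive automorphisms in question, then \<open>\<phi>(y)\<close> commutes with \<open>t\<close>
  as soon as \<open>y\<close> commutes with the preimage of \<open>t\<close>. The preimage need not lie in \<open>T\<close>: any element
  that commutes with everything commuting with \<open>T\<close> will do. This weakening is made for \<open>stars\<close>, which need not
  be invariant under \<open>\<lambda>\<close> or under additive conjugation.
\<close>
lemma add_centralizer_ideal:
  assumes T: "T \<subseteq> carrier B"
    and add_conj: "\<And>c t. \<lbrakk>c \<in> carrier B; t \<in> T\<rbrakk> \<Longrightarrow> c \<oplus> t \<oplus> \<ominus> c \<in> add_centralizer (add_centralizer T)"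
    and lam: "\<And>c t. \<lbrakk>c \<in> carrier B; t \<in> T\<rbrakk> \<Longrightarrow> brace_lambda B c t \<in> add_centralizer (add_centralizer T)"
    and conj: "\<And>c t. \<lbrakk>c \<in> carrier B; t \<in> T\<rbrakk> \<Longrightarrow> inv\<^bsub>B\<^esub> c \<otimes> t \<otimes> c \<in> add_centralizer (add_centralizer T)"
  shows "skew_brace_ideal (add_centralizer T) B"
proof (rule skew_brace_idealI)
  show "subgroup (add_centralizer T) (add_monoid B)" by (rule add_centralizer_subgroup[OF T])
  have transfer: "\<phi> y \<in> add_centralizer T"
    if y: "y \<in> add_centralizer T" and \<phi>: "\<phi> \<in> hom (add_monoid B) (add_monoid B)"
      and \<psi>: "\<And>t. t \<in> T \<Longrightarrow> \<psi> t \<in> add_centralizer (add_centralizer T)" "\<And>t. t \<in> T \<Longrightarrow> \<phi> (\<psi> t) = t"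
    for y \<phi> \<psi>
  proof -
    have "\<phi> y \<oplus> t = t \<oplus> \<phi> y" if t: "t \<in> T" for t
    proof -
      have [simp]: "y \<in> carrier B" "\<psi> t \<in> carrier B"
        using y \<psi>(1)[OF t] by (auto simp: add_centralizer_def)
      have "\<psi> t \<oplus> y = y \<oplus> \<psi> t" using y \<psi>(1)[OF t] unfolding add_centralizer_def by blast
      moreover have "\<phi> (\<psi> t \<oplus> y) = \<phi> (\<psi> t) \<oplus> \<phi> y" "\<phi> (y \<oplus> \<psi> t) = \<phi> y \<oplus> \<phi> (\<psi> t)"
        using \<phi> by (simp_all add: hom_def)
      ultimately show ?thesis by (simp add: \<psi>(2)[OF t])
    qed
    then show ?thesis using y \<phi> by (auto simp: add_centralizer_def hom_def)
  qed
  fix c y assume c: "c \<in> carrier B" and y: "y \<in> add_centralizer T"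
  show "c \<oplus> y \<oplus> \<ominus> c \<in> add_centralizer T"
  proof (rule transfer[OF y, of "\<lambda>x. c \<oplus> x \<oplus> \<ominus> c" "\<lambda>t. \<ominus> c \<oplus> t \<oplus> c"])
    show "\<ominus> c \<oplus> t \<oplus> c \<in> add_centralizer (add_centralizer T)" if "t \<in> T" for t
      using add_conj[of "\<ominus> c" t] c that by simp
    show "c \<oplus> (\<ominus> c \<oplus> t \<oplus> c) \<oplus> \<ominus> c = t" if "t \<in> T" for t
      using that c T by (auto simp: add_word subset_iff)
  qed (use c in \<open>simp add: hom_def add_word\<close>)
  show "brace_lambda B c y \<in> add_centralizer T"
    by (rule transfer[OF y lambda_hom, of c "brace_lambda B (inv\<^bsub>B\<^esub> c)"])
      (use c T lam in \<open>auto simp: lambda_inv_cancel subset_iff\<close>)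
  show "inv\<^bsub>B\<^esub> c \<otimes> y \<otimes> c \<in> add_centralizer T"
  proof (rule transfer[OF y conj_hom, of c "\<lambda>t. c \<otimes> t \<otimes> inv\<^bsub>B\<^esub> c"])
    show "c \<otimes> t \<otimes> inv\<^bsub>B\<^esub> c \<in> add_centralizer (add_centralizer T)" if "t \<in> T" for t
      using conj[of "inv\<^bsub>B\<^esub> c" t] c that by simp
    show "inv\<^bsub>B\<^esub> c \<otimes> (c \<otimes> t \<otimes> inv\<^bsub>B\<^esub> c) \<otimes> c = t" if "t \<in> T" for t
    proof -
      have [simp]: "t \<in> carrier B" using that T by auto
      have "inv\<^bsub>B\<^esub> c \<otimes> (c \<otimes> t \<otimes> inv\<^bsub>B\<^esub> c) \<otimes> c = (inv\<^bsub>B\<^esub> c \<otimes> c) \<otimes> t \<otimes> (inv\<^bsub>B\<^esub> c \<otimes> c)"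
        using c by (simp only: C.m_assoc C.m_closed C.inv_closed \<open>t \<in> carrier B\<close>)
      then show ?thesis using c by simp
    qed
  qed (use c in simp)
qed

text \<open>These are the elements \<open>a * b = \<lambda>\<^sub>a(b) - b\<close>, which measure how far \<open>\<circ>\<close> is from \<open>+\<close>.\<close>
definition stars :: "'a set" where
  "stars = {\<ominus> a \<oplus> a \<otimes> b \<oplus> \<ominus> b |a b. a \<in> carrier B \<and> b \<in> carrier B}"

lemma star_mem_stars: "\<lbrakk>a \<in> carrier B; b \<in> carrier B\<rbrakk> \<Longrightarrow> \<ominus> a \<oplus> a \<otimes> b \<oplus> \<ominus> b \<in> stars"
  by (auto simp: stars_def)

lemma stars_carrier: "stars \<subseteq> carrier B"
  by (auto simp: stars_def)

text \<open>
  For \<open>a * b = \<lambda>\<^sub>a(b) - b\<close> one has \<open>c + a * b - c = -(a * c) + a * (c + b)\<close> and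
  \<open>\<lambda>\<^sub>c(a * b) = (c \<circ> a) * b - c * b\<close>, while conjugation in \<open>(B, \<circ>)\<close> is a skew brace automorphism and therefore
  permutes the stars.
\<close>
lemma stars_centralizer_ideal: "skew_brace_ideal (add_centralizer stars) B"
proof (rule add_centralizer_ideal[OF stars_carrier])
  let ?D = "add_centralizer (add_centralizer stars)"
  have mem: "\<ominus> a \<oplus> a \<otimes> b \<oplus> \<ominus> b \<in> ?D" if "a \<in> carrier B" "b \<in> carrier B" for a b
    using add_double_centralizer[OF stars_carrier] star_mem_stars[OF that] by blast
  have sub: "add_centralizer stars \<subseteq> carrier B" by (auto simp: add_centralizer_def)
  fix c t assume c [simp]: "c \<in> carrier B" and "t \<in> stars"
  then obtain a b where ab [simp]: "a \<in> carrier B" "b \<in> carrier B"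
    and t: "t = \<ominus> a \<oplus> a \<otimes> b \<oplus> \<ominus> b" by (auto simp: stars_def)
  have add_conj: "c \<oplus> t \<oplus> \<ominus> c =
      \<ominus> (\<ominus> a \<oplus> a \<otimes> c \<oplus> \<ominus> c) \<oplus> (\<ominus> a \<oplus> a \<otimes> (c \<oplus> b) \<oplus> \<ominus> (c \<oplus> b))"
    unfolding t by (simp add: brace a_minus_def add_word)
  show "c \<oplus> t \<oplus> \<ominus> c \<in> ?D"
    unfolding add_conj by (intro add_centralizer_diff[OF sub] mem) simp_all
  have lam: "brace_lambda B c t =
      (\<ominus> (c \<otimes> a) \<oplus> (c \<otimes> a) \<otimes> b \<oplus> \<ominus> b) \<oplus> \<ominus> (\<ominus> c \<oplus> c \<otimes> b \<oplus> \<ominus> b)"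
    unfolding t by (simp add: lambda_add lambda_minus) (simp add: brace_lambda_def C.m_assoc add_word)
  show "brace_lambda B c t \<in> ?D"
    unfolding lam by (intro add_centralizer_diff[OF sub] mem) simp_all
  have "inv\<^bsub>B\<^esub> c \<otimes> (a \<otimes> b) \<otimes> c = (inv\<^bsub>B\<^esub> c \<otimes> a \<otimes> c) \<otimes> (inv\<^bsub>B\<^esub> c \<otimes> b \<otimes> c)"
  proof -
    have "inv\<^bsub>B\<^esub> c \<otimes> a \<otimes> c \<otimes> (inv\<^bsub>B\<^esub> c \<otimes> b \<otimes> c) = inv\<^bsub>B\<^esub> c \<otimes> a \<otimes> (c \<otimes> inv\<^bsub>B\<^esub> c) \<otimes> b \<otimes> c"
      by (simp only: C.m_assoc C.m_closed C.inv_closed c ab)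
    then show ?thesis by (simp add: C.m_assoc)
  qed
  then have conj: "inv\<^bsub>B\<^esub> c \<otimes> t \<otimes> c = \<ominus> (inv\<^bsub>B\<^esub> c \<otimes> a \<otimes> c) \<oplus>
      (inv\<^bsub>B\<^esub> c \<otimes> a \<otimes> c) \<otimes> (inv\<^bsub>B\<^esub> c \<otimes> b \<otimes> c) \<oplus> \<ominus> (inv\<^bsub>B\<^esub> c \<otimes> b \<otimes> c)"
    unfolding t by (simp add: conj_add conj_minus)
  show "inv\<^bsub>B\<^esub> c \<otimes> t \<otimes> c \<in> ?D" unfolding conj by (intro mem) simp_all
qed

lemma centralizer_of_ideal:
  assumes I: "skew_brace_ideal I B"
  shows "skew_brace_ideal (add_centralizer I) B"
proof -
  have sub: "I \<subseteq> carrier B"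
    using ideal_sub_skew_brace[OF I] C.subgroupE(1) by (simp add: sub_skew_brace_def)
  note D = add_double_centralizer[OF sub, THEN subsetD]
  show ?thesis
    by (intro add_centralizer_ideal sub D ideal_add_conj[OF I] ideal_lambda[OF I] ideal_conj[OF I])
qed

text \<open>The torsion part is preserved by every additive automorphism that preserves \<open>Z\<close>.\<close>
lemma torsion_ideal:
  assumes Z: "skew_brace_ideal Z B"
    and comm: "\<And>x y. \<lbrakk>x \<in> Z; y \<in> Z\<rbrakk> \<Longrightarrow> x \<oplus> y = y \<oplus> x"
  shows "skew_brace_ideal {z \<in> Z. z [^]\<^bsub>add_monoid B\<^esub> (m::nat) = \<zero>} B" (is "skew_brace_ideal ?M B")
proof (rule skew_brace_idealI)
  interpret Z: subgroup Z "add_monoid B"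
    rewrites "carrier (add_monoid B) = carrier B"
      and "monoid.mult (add_monoid B) = ring.add B"
      and "monoid.one (add_monoid B) = ring.zero B"
      and "m_inv (add_monoid B) = a_inv B"
    using ideal_sub_skew_brace[OF Z] by (simp_all add: a_inv_def sub_skew_brace_def)
  show "subgroup ?M (add_monoid B)"
  proof (rule group.subgroupI[OF add_group])
    show "?M \<noteq> {}" using Z.one_closed A.nat_pow_one by blast
  qed (auto simp: A.nat_pow_inv A.pow_mult_distrib comm simp flip: a_inv_def)
  have pow: "\<phi> z [^]\<^bsub>add_monoid B\<^esub> m = \<zero>"
    if \<phi>: "\<phi> \<in> hom (add_monoid B) (add_monoid B)" and z: "z \<in> ?M" for \<phi> z
  proof -
    interpret \<phi>: group_hom "add_monoid B" "add_monoid B" \<phi>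
      using \<phi> add_group by (simp add: group_hom_def group_hom_axioms_def)
    have "\<phi> (z [^]\<^bsub>add_monoid B\<^esub> m) = \<phi> z [^]\<^bsub>add_monoid B\<^esub> m" using z by (intro \<phi>.hom_nat_pow) simp
    then show ?thesis using z \<phi>.hom_one by simp
  qed
  fix c z assume c: "c \<in> carrier B" and z: "z \<in> ?M"
  have "(\<lambda>x. c \<oplus> x \<oplus> \<ominus> c) \<in> hom (add_monoid B) (add_monoid B)"
    using c by (simp add: hom_def add_word)
  from pow[OF this z] show "c \<oplus> z \<oplus> \<ominus> c \<in> ?M" using ideal_add_conj[OF Z c] z by simp
  show "brace_lambda B c z \<in> ?M" using pow[OF lambda_hom[OF c] z] ideal_lambda[OF Z c] z by simp
  show "inv\<^bsub>B\<^esub> c \<otimes> z \<otimes> c \<in> ?M" using pow[OF conj_hom[OF c] z] ideal_conj[OF Z c] z by simp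
qed

end

section \<open>Sylow and Hall subgroups\<close>

text \<open>
  Maximality of \<open>|P|\<close> enters only through orders: \<open>K/M\<close> is a \<open>\<pi>\<close>-group whose order divides \<open>|B|\<close>, so
  \<open>|K : M| \<le> |P|\<close>, which forces \<open>K = M \<circ> P\<close>.
\<close>
lemma (in two_sided_skew_brace) maximal_pi_subgroup_add_subgroup:
  assumes fin: "finite (carrier B)" and P: "subgroup P B" and piP: "pi_number \<pi> (card P)"
    and maximal: "\<And>d. \<lbrakk>pi_number \<pi> d; d dvd order B\<rbrakk> \<Longrightarrow> d \<le> card P"
  shows "subgroup P (add_monoid B)"
proof -
  (* Taking X to be the centralizer of Y, instead of the ideal generated by the stars, makes X \<inter> Y
     abelian by definition; X still contains the stars. *)
  define Y where "Y = add_centralizer stars"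
  define X where "X = add_centralizer Y"
  define Z where "Z = X \<inter> Y"
  have Y: "skew_brace_ideal Y B" unfolding Y_def by (rule stars_centralizer_ideal)
  have X: "skew_brace_ideal X B" unfolding X_def by (rule centralizer_of_ideal[OF Y])
  have Z: "skew_brace_ideal Z B" unfolding Z_def by (rule ideal_Int[OF X Y])
  have Z_comm: "x \<oplus> y = y \<oplus> x" if "x \<in> Z" "y \<in> Z" for x y
  proof -
    have "x \<in> add_centralizer Y" "y \<in> Y" using that by (simp_all add: Z_def X_def)
    then show ?thesis unfolding add_centralizer_def by blast
  qed
  note idealD = ideal_sub_skew_brace[unfolded sub_skew_brace_def, THEN conjunct1]
    ideal_sub_skew_brace[unfolded sub_skew_brace_def, THEN conjunct2]
  have PB: "p \<in> carrier B" if "p \<in> P" for p using subgroup.mem_carrier[OF P that] .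

  define K where "K = (X <#> P) \<inter> (Y <#> P)"
  note XP = subgroup_mult_ideal[OF X P] and YP = subgroup_mult_ideal[OF Y P]
  have star_X: "\<ominus> a \<oplus> a \<otimes> b \<oplus> \<ominus> b \<in> X" if "a \<in> carrier B" "b \<in> carrier B" for a b
    unfolding X_def Y_def
    by (intro subsetD[OF add_double_centralizer[OF stars_carrier]] star_mem_stars that)
  have star_Y: "\<ominus> b \<oplus> a \<otimes> b \<oplus> \<ominus> a \<in> Y" if "a \<in> carrier B" "b \<in> carrier B" for a b
  proof -
    have "(\<ominus> b \<oplus> a \<otimes> b \<oplus> \<ominus> a) \<oplus> t = t \<oplus> (\<ominus> b \<oplus> a \<otimes> b \<oplus> \<ominus> a)" if "t \<in> stars" for t
    proof -
      obtain u v where "u \<in> carrier B" "v \<in> carrier B" "t = \<ominus> u \<oplus> u \<otimes> v \<oplus> \<ominus> v"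
        using \<open>t \<in> stars\<close> by (auto simp: stars_def)
      then show ?thesis using star_commute[of u a b v] \<open>a \<in> carrier B\<close> \<open>b \<in> carrier B\<close> by simp
    qed
    then show ?thesis using that by (simp add: Y_def add_centralizer_def)
  qed
  (* B/X is a trivial skew brace and in B/Y the operation \<circ> is the opposite of +, so additive closure
     of X \<circ> P and Y \<circ> P follows from multiplicative closure. *)
  have XP_add: "subgroup (X <#> P) (add_monoid B)"
  proof (rule add_subgroup_if_mod_ideal[OF fin X XP(1,2)])
    fix a b assume ab: "a \<in> X <#> P" "b \<in> X <#> P"
    then have [simp]: "a \<in> carrier B" "b \<in> carrier B" using subgroup.mem_carrier[OF XP(1)] by auto
    have "a \<oplus> (\<ominus> a \<oplus> a \<otimes> b \<oplus> \<ominus> b) \<oplus> \<ominus> a \<in> X" by (intro ideal_add_conj[OF X] star_X) simp_all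
    then have "a \<otimes> b \<oplus> \<ominus> (a \<oplus> b) \<in> X" by (simp add: add_word)
    then have "X +> (a \<otimes> b) = X +> (a \<oplus> b)" by (intro coset_eq_if_diff_mem[OF X]) simp_all
    then show "\<exists>h\<in>X <#> P. X +> (a \<oplus> b) = X +> h"
      using subgroup.m_closed[OF XP(1) ab] by metis
  qed
  have YP_add: "subgroup (Y <#> P) (add_monoid B)"
  proof (rule add_subgroup_if_mod_ideal[OF fin Y YP(1,2)])
    fix a b assume ab: "a \<in> Y <#> P" "b \<in> Y <#> P"
    then have [simp]: "a \<in> carrier B" "b \<in> carrier B" using subgroup.mem_carrier[OF YP(1)] by auto
    have "a \<oplus> (\<ominus> a \<oplus> b \<otimes> a \<oplus> \<ominus> b) \<oplus> \<ominus> a \<in> Y" by (intro ideal_add_conj[OF Y] star_Y) simp_all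
    then have "b \<otimes> a \<oplus> \<ominus> (a \<oplus> b) \<in> Y" by (simp add: add_word)
    then have "Y +> (b \<otimes> a) = Y +> (a \<oplus> b)" by (intro coset_eq_if_diff_mem[OF Y]) simp_all
    then show "\<exists>h\<in>Y <#> P. Y +> (a \<oplus> b) = Y +> h"
      using subgroup.m_closed[OF YP(1) ab(2) ab(1)] by metis
  qed
  have K: "subgroup K B" unfolding K_def by (rule C.subgroups_Inter_pair[OF XP(1) YP(1)])
  have K_add: "subgroup K (add_monoid B)"
    unfolding K_def by (rule group.subgroups_Inter_pair[OF add_group XP_add YP_add])
  have ZK: "Z \<subseteq> K" and PK: "P \<subseteq> K"
    using XP(2,3) YP(2,3) unfolding Z_def K_def by blast+
  have finK: "finite K" using fin subgroup.subset[OF K] by (rule rev_finite_subset)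
  have finZ: "finite Z" using ZK finK by (rule finite_subset)

  have "0 < card Z" using finZ subgroup.one_closed[OF idealD(2)[OF Z]] by (auto simp: card_gt_0_iff)
  then obtain r m where rm: "card Z = r * m" "pi_number \<pi> r" "pi_number (- \<pi>) m"
    by (rule pi_number_decompose)
  define M where "M = {z \<in> Z. z [^]\<^bsub>add_monoid B\<^esub> m = \<zero>}"
  have M: "skew_brace_ideal M B" unfolding M_def by (rule torsion_ideal[OF Z Z_comm])
  have MZ: "M \<subseteq> Z" by (auto simp: M_def)
  have finM: "finite M" using MZ finZ by (rule finite_subset)

  (* A common prime divisor would divide m by Cauchy's theorem, since m annihilates (M, +). *)
  have coprime: "coprime (card M) (card P)"
  proof (rule ccontr)
    assume "\<not> coprime (card M) (card P)"
    then have "gcd (card M) (card P) \<noteq> 1" by (simp add: coprime_iff_gcd_eq_1)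
    then obtain q where q: "Factorial_Ring.prime q" "q dvd card M" "q dvd card P"
      using prime_factor_nat[of "gcd (card M) (card P)"] by auto
    interpret N: group "(add_monoid B)\<lparr>carrier := M\<rparr>"
      by (rule subgroup.subgroup_is_group[OF idealD(1)[OF M] add_group])
    have "q dvd m"
    proof (rule N.prime_dvd_order_imp_dvd_exponent[OF _ q(1)])
      show "q dvd order ((add_monoid B)\<lparr>carrier := M\<rparr>)" using q by (simp add: order_def)
      fix x assume "x \<in> carrier ((add_monoid B)\<lparr>carrier := M\<rparr>)"
      then show "x [^]\<^bsub>(add_monoid B)\<lparr>carrier := M\<rparr>\<^esub> m = \<one>\<^bsub>(add_monoid B)\<lparr>carrier := M\<rparr>\<^esub>"
        using A.nat_pow_consistent[of x m M] by (simp add: M_def)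
    qed (use finM in simp)
    then show False using q rm(3) piP by (auto simp: pi_number_def)
  qed

  define i where "i = card (rcosets\<^bsub>B\<lparr>carrier := K\<rparr>\<^esub> Z)"
  (* By Cauchy's theorem it suffices to bound exponents: the power with exponent |P| maps X \<circ> P into X and
     Y \<circ> P into Y, hence K into Z. *)
  have index_K: "pi_number \<pi> i" and card_K: "i * card Z = card K"
  proof -
    interpret GK: group "B\<lparr>carrier := K\<rparr>"
      by (rule subgroup.subgroup_is_group[OF K circ_group])
    interpret ZN: normal Z "B\<lparr>carrier := K\<rparr>"
      using C.normal_restrict_supergroup[OF K _ ZK] Z by (simp add: skew_brace_ideal_def)
    show card: "i * card Z = card K"
      using GK.lagrange[OF ZN.subgroup_axioms] by (simp add: order_def i_def)
    have "q \<in> \<pi>" if q: "Factorial_Ring.prime q" "q dvd i" for q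
    proof -
      have "q dvd card P"
      proof (rule ZN.prime_dvd_index_imp_dvd_exponent[OF _ q[unfolded i_def]])
        fix x assume "x \<in> carrier (B\<lparr>carrier := K\<rparr>)"
        then have x: "x \<in> X <#> P" "x \<in> Y <#> P" by (auto simp: K_def)
        have "x [^] card P \<in> Z"
          unfolding Z_def using x P X Y
          by (auto simp: skew_brace_ideal_def intro: normal.pow_card_mem_normal)
        then show "x [^]\<^bsub>B\<lparr>carrier := K\<rparr>\<^esub> card P \<in> Z" by (simp add: C.nat_pow_consistent[symmetric])
      qed (use finK in simp)
      then show ?thesis using q piP by (auto simp: pi_number_def)
    qed
    moreover have "0 < i"
    proof (rule ccontr)
      assume "\<not> 0 < i"
      then have "card K = 0" using card by simp
      then show False using finK subgroup.one_closed[OF K] by auto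
    qed
    ultimately show "pi_number \<pi> i" by (simp add: pi_number_def)
  qed

  define j where "j = card (rcosets\<^bsub>(add_monoid B)\<lparr>carrier := Z\<rparr>\<^esub> M)"
  (* The exponent of (Z, +) divides r m, so the multiple by r of any element of Z is annihilated by m. *)
  have index_Z: "pi_number \<pi> j" and card_Z: "j * card M = card Z"
  proof -
    interpret GZ: group "(add_monoid B)\<lparr>carrier := Z\<rparr>"
      by (rule subgroup.subgroup_is_group[OF idealD(1)[OF Z] add_group])
    interpret MN: normal M "(add_monoid B)\<lparr>carrier := Z\<rparr>"
      using group.normal_restrict_supergroup[OF add_group idealD(1)[OF Z] _ MZ] M
      by (simp add: skew_brace_ideal_def)
    show card: "j * card M = card Z"
      using GZ.lagrange[OF MN.subgroup_axioms] by (simp add: order_def j_def)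
    have "q \<in> \<pi>" if q: "Factorial_Ring.prime q" "q dvd j" for q
    proof -
      have "q dvd r"
      proof (rule MN.prime_dvd_index_imp_dvd_exponent[OF _ q[unfolded j_def]])
        fix x assume "x \<in> carrier ((add_monoid B)\<lparr>carrier := Z\<rparr>)"
        then have x: "x \<in> Z" by simp
        have xB: "x \<in> carrier B" using ZK subgroup.subset[OF K] x by auto
        have "x [^]\<^bsub>(add_monoid B)\<lparr>carrier := Z\<rparr>\<^esub> card Z = \<zero>"
          using GZ.pow_order_eq_1[of x] x by (simp add: order_def)
        then have "x [^]\<^bsub>add_monoid B\<^esub> (r * m) = \<zero>"
          using A.nat_pow_consistent[of x "card Z" Z] by (simp add: rm(1))
        then have "(x [^]\<^bsub>add_monoid B\<^esub> r) [^]\<^bsub>add_monoid B\<^esub> m = \<zero>" using xB by (simp add: A.nat_pow_pow)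
        moreover have "x [^]\<^bsub>(add_monoid B)\<lparr>carrier := Z\<rparr>\<^esub> r \<in> Z" using GZ.nat_pow_closed[of x r] x by simp
        ultimately show "x [^]\<^bsub>(add_monoid B)\<lparr>carrier := Z\<rparr>\<^esub> r \<in> M"
          using A.nat_pow_consistent[of x r Z] by (simp add: M_def)
      qed (use finZ in simp)
      then show ?thesis using q rm(2) by (auto simp: pi_number_def)
    qed
    moreover have "0 < j"
    proof (rule ccontr)
      assume "\<not> 0 < j"
      then have "card Z = 0" using card by simp
      then show False using finZ subgroup.one_closed[OF idealD(2)[OF Z]] by auto
    qed
    ultimately show "pi_number \<pi> j" by (simp add: pi_number_def)
  qed

  have card_MP: "card (M <#> P) = card M * card P"
    by (rule C.card_set_mult_coprime[OF idealD(2)[OF M] P coprime])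
  have MP_K: "M <#> P = K"
  proof (rule card_seteq[OF finK])
    show "M <#> P \<subseteq> K"
    proof
      fix x assume "x \<in> M <#> P"
      then obtain a p where ap: "a \<in> M" "p \<in> P" and x: "x = a \<otimes> p" by (auto simp: set_mult_def)
      show "x \<in> K" unfolding x using ap MZ ZK PK by (intro subgroup.m_closed[OF K]) auto
    qed
    have card_K': "card K = (i * j) * card M" using card_K card_Z by (simp add: mult.assoc)
    then have "i * j dvd card K" by simp
    moreover have "card K dvd order B" using C.lagrange[OF K] by (metis dvd_triv_right)
    ultimately have "i * j \<le> card P"
      by (intro maximal pi_number_mult index_K index_Z) (rule dvd_trans)
    then show "card K \<le> card (M <#> P)" using card_K' card_MP by simp
  qed
  interpret coprime_abelian_ideal B M P
  proof (intro coprime_abelian_ideal.intro coprime_abelian_ideal_axioms.intro)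
    show "two_sided_skew_brace B" by (rule two_sided_skew_brace_axioms)
    show "x \<oplus> y = y \<oplus> x" if "x \<in> M" "y \<in> M" for x y using Z_comm that MZ by auto
    show "subgroup (M <#> P) (add_monoid B)" unfolding MP_K by (rule K_add)
    show "coprime (card P) (card M)" using coprime by (simp add: coprime_commute)
  qed (fact fin M P)+
  show ?thesis
  proof (rule group.finite_closed_imp_subgroup[OF add_group finite_P])
    show "P \<subseteq> carrier (add_monoid B)" using PB by auto
    show "P \<noteq> {}" using subgroup.one_closed[OF P] by blast
  qed (simp add: P_add_closed)
qed

theorem theorem14:
  fixes B :: "('a, 'b) ring_scheme"
  assumes "two_sided_skew_brace B" and "finite (carrier B)"
  shows "(\<forall>p::nat. Factorial_Ring.prime p \<longrightarrow>
            (\<forall>H. sylow_sub_skew_brace p H B \<longleftrightarrow> sylow_subgroup p H B))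
       \<and> (\<forall>\<pi>::nat set. (\<forall>q\<in>\<pi>. Factorial_Ring.prime q) \<and> soluble_skew_brace B \<longrightarrow>
            (\<forall>H. hall_sub_skew_brace \<pi> H B \<longleftrightarrow> hall_subgroup \<pi> H B))"
proof -
  interpret two_sided_skew_brace B by (rule assms(1))
  have order_pos: "0 < order B" using assms(2) C.order_gt_0_iff_finite by blast
  have sylow: "sub_skew_brace H B"
    if p: "Factorial_Ring.prime p" and H: "subgroup H B" "card H = p ^ multiplicity p (order B)" for p H
    unfolding sub_skew_brace_def
  proof
    show "subgroup H (add_monoid B)"
      using pi_number_prime_power[OF p] pi_number_singleton_le[OF p _ _ order_pos]
      by (intro maximal_pi_subgroup_add_subgroup[where \<pi> = "{p}"] assms(2) H(1)) (simp_all add: H(2))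
  qed (rule H)
  have hall: "sub_skew_brace H B"
    if H: "subgroup H B" "card H = Max {d. pi_number \<pi> d \<and> d dvd order B}" for \<pi> H
    unfolding sub_skew_brace_def
  proof
    let ?D = "{d. pi_number \<pi> d \<and> d dvd order B}"
    have fin: "finite ?D" using finite_divisors_nat[OF order_pos] by (rule rev_finite_subset) auto
    have "1 \<in> ?D" by (auto simp: pi_number_def)
    then have "card H \<in> ?D" unfolding H(2) by (intro Max_in[OF fin]) auto
    moreover have "d \<le> card H" if "d \<in> ?D" for d unfolding H(2) using fin that by (rule Max_ge)
    ultimately show "subgroup H (add_monoid B)"
      by (intro maximal_pi_subgroup_add_subgroup[where \<pi> = \<pi>] assms(2) H(1)) auto
  qed (rule H)
  have "sylow_sub_skew_brace p H B \<longleftrightarrow> sylow_subgroup p H B" if "Factorial_Ring.prime p" for p H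
    unfolding sylow_sub_skew_brace_def sylow_subgroup_def
    using sylow[OF that, of H] by (auto simp: sub_skew_brace_def)
  moreover have "hall_sub_skew_brace \<pi> H B \<longleftrightarrow> hall_subgroup \<pi> H B" for \<pi> H
    unfolding hall_sub_skew_brace_def hall_subgroup_def
    using hall[of H \<pi>] by (auto simp: sub_skew_brace_def)
  ultimately show ?thesis by blast
qed

end
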